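(* Let $(\mathcal{O}_*,\Delta_\varphi)$ be the $C^*$-bialgebra with $\mathcal{O}_*=\bigoplus_{n\in\mathbf{N}}\mathcal{O}_n$ the $C^*$-algebraic direct sum of the Cuntz algebras $\mathcal{O}_n$ ($n\in\mathbf{N}=\{1,2,3,\ldots\}$, $\mathcal{O}_1=\mathbf{C}$), and with comultiplication $\Delta_\varphi$ induced by the embeddings $\varphi_{n,m}:\mathcal{O}_{nm}\to\mathcal{O}_n\otimes\mathcal{O}_m$, $\varphi_{n,m}(s^{(nm)}_{m(i-1)+j})=s^{(n)}_i\otimes s^{(m)}_j$ (see context). Then there is no universal $R$-matrix of $(\mathcal{O}_*,\Delta_\varphi)$; that is, there is no unitary element $R\in M(\mathcal{O}_*\otimes\mathcal{O}_* )$ such that $R\,\Delta_\varphi(x)\,R^*=\Delta_\varphi^{op}(x)$ for all $x\in\mathcal{O}_*$.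
   Context: Notation: $\otimes$ of $C^*$-algebras is the minimal $C^*$-tensor product. $M(A)$ is the multiplier algebra of a $C^*$-algebra $A$. A $*$-homomorphism $f:A\to M(B)$ is nondegenerate if $f(A)B$ is dense (spans a dense subspace) in $B$; such an $f$ extends uniquely to a $*$-homomorphism $M(A)\to M(B)$. $C^*$-bialgebra: a pair $(A,\Delta)$ with $A$ a $C^*$-algebra (not necessarily unital) and $\Delta:A\to M(A\otimes A)$ a nondegenerate $*$-homomorphism with $(\Delta\otimes \mathrm{id})\circ\Delta=(\mathrm{id}\otimes\Delta)\circ\Delta$ (using the extensions to multiplier algebras). $\Delta$ is called the comultiplication. Opposite comultiplication: let $\tau_{A,A}$ be the flip $x\otimes y\mapsto y\otimes x$ on $A\otimes A$. The extended flip $\tilde\tau_{A,A}:M(A\otimes A)\to M(A\otimes A)$ is defined by $\tilde\tau_{A,A}(X)(x\otimes y)=\tau_{A,A}(X(y\otimes x))$ for $X\in M(A\otimes A)$, $x\otimes y\in A\otimes A$. Put $\Delta^{op}(x)=\tilde\tau_{A,A}(\Delta(x))$ for $x\in A$. Universal $R$-matrix: a (unitary) universal $R$-matrix of $(A,\Delta)$ is a unitary $R\in M(A\otimes A)$ with $R\Delta(x)R^*=\Delta^{op}(x)$ for all $x\in A$. No further condition is required. The $C^*$-bialgebra $(\mathcal{O}_*,\Delta_\varphi)$: for $2\le n<\infty$, $\mathcal{O}_n$ is the Cuntz algebra, i.e. the universal unital $C^*$-algebra generated by $s^{(n)}_1,\ldots,s^{(n)}_n$ with $(s^{(n)}_i)^*s^{(n)}_j=\delta_{ij}I$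 and $\sum_{i=1}^n s^{(n)}_i(s^{(n)}_i)^*=I$; $\mathcal{O}_1=\mathbf{C}$ with $s^{(1)}_1$ its unit. Set $$\mathcal{O}_*=\bigoplus_{n\in\mathbf{N}}\mathcal{O}_n=\{(x_n)_{n\in\mathbf N}: x_n\in\mathcal{O}_n,\ \|x_n\|\to0\text{ as }n\to\infty\}.$$ For $n,m\in\mathbf{N}$, $\varphi_{n,m}:\mathcal{O}_{nm}\to\mathcal{O}_n\otimes\mathcal{O}_m$ is the unital $*$-embedding determined by $\varphi_{n,m}(s^{(nm)}_{m(i-1)+j})=s^{(n)}_i\otimes s^{(m)}_j$ for $i=1,\ldots,n$, $j=1,\ldots,m$. The $*$-homomorphism $\Delta_\varphi:\mathcal{O}_*\to\mathcal{O}_*\otimes\mathcal{O}_*$ is $\Delta_\varphi=\bigoplus_{n\in\mathbf{N}}\Delta_\varphi^{(n)}$, where $\Delta_\varphi^{(n)}(x)=\sum_{(m,l)\in\mathbf{N}^2,\ ml=n}\varphi_{m,l}(x)$ for $x\in\mathcal{O}_n$, with $\mathcal{O}_m\otimes\mathcal{O}_l$ regarded as a direct summand of $\mathcal{O}_*\otimes\mathcal{O}_*$. It is known that $(\mathcal{O}_*,\Delta_\varphi)$ is a $C^*$-bialgebra, where $\mathcal{O}_*\otimes\mathcal{O}_*\subset M(\mathcal{O}_*\otimes\mathcal{O}_* )$. *)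

theory Defs
  imports "HOL-Analysis.Analysis"
begin

section \<open>The Hilbert space of square-summable functions\<close>

class scaleC =
  fixes scaleC :: "complex \<Rightarrow> 'a \<Rightarrow> 'a" (infixr "*\<^sub>C" 75)

typedef 'x ell2 = "{f :: 'x \<Rightarrow> complex. (\<lambda>x. (cmod (f x))\<^sup>2) summable_on UNIV}"
  morphisms ell2_fun Abs_ell2
  by (rule exI[of _ "\<lambda>_. 0"]) simp

setup_lifting type_definition_ell2

lemma ell2_summable: "(\<lambda>x. (cmod (ell2_fun f x))\<^sup>2) summable_on UNIV"
  using ell2_fun[of f] by simp

lemma ell2_eqI: "(\<And>x. ell2_fun f x = ell2_fun g x) \<Longrightarrow> f = g"
  by (metis ell2_fun_inject ext)

lemma sq_summable_add:
  fixes f g :: "'x \<Rightarrow> complex"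
  assumes "(\<lambda>x. (cmod (f x))\<^sup>2) summable_on UNIV" "(\<lambda>x. (cmod (g x))\<^sup>2) summable_on UNIV"
  shows "(\<lambda>x. (cmod (f x + g x))\<^sup>2) summable_on UNIV"
proof (rule summable_on_comparison_test)
  show "(\<lambda>x. 2 * (cmod (f x))\<^sup>2 + 2 * (cmod (g x))\<^sup>2) summable_on UNIV"
    by (intro summable_on_add summable_on_cmult_right assms)
  show "(cmod (f x + g x))\<^sup>2 \<le> 2 * (cmod (f x))\<^sup>2 + 2 * (cmod (g x))\<^sup>2" for x
  proof -
    have "(cmod (f x + g x))\<^sup>2 \<le> (cmod (f x) + cmod (g x))\<^sup>2"
      by (simp add: norm_triangle_ineq power_mono)
    also have "\<dots> \<le> 2 * (cmod (f x))\<^sup>2 + 2 * (cmod (g x))\<^sup>2"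
      using zero_le_power2[of "cmod (f x) - cmod (g x)"] by (simp add: power2_eq_square algebra_simps)
    finally show ?thesis .
  qed
qed simp

lemma sq_summable_scale:
  fixes f :: "'x \<Rightarrow> complex"
  assumes "(\<lambda>x. (cmod (f x))\<^sup>2) summable_on UNIV"
  shows "(\<lambda>x. (cmod (c * f x))\<^sup>2) summable_on UNIV"
  using summable_on_cmult_right[OF assms, of "(cmod c)\<^sup>2"] by (simp add: norm_mult power_mult_distrib)

lemma ell2_prod_summable: "(\<lambda>x. cnj (ell2_fun f x) * ell2_fun g x) summable_on UNIV"
proof (rule abs_summable_summable, rule summable_on_comparison_test)
  show "(\<lambda>x. (cmod (ell2_fun f x))\<^sup>2 + (cmod (ell2_fun g x))\<^sup>2) summable_on UNIV"
    by (intro summable_on_add ell2_summable)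
  show "cmod (cnj (ell2_fun f x) * ell2_fun g x) \<le> (cmod (ell2_fun f x))\<^sup>2 + (cmod (ell2_fun g x))\<^sup>2" for x
  proof -
    have "2 * (cmod (ell2_fun f x) * cmod (ell2_fun g x)) \<le> (cmod (ell2_fun f x))\<^sup>2 + (cmod (ell2_fun g x))\<^sup>2"
      using zero_le_power2[of "cmod (ell2_fun f x) - cmod (ell2_fun g x)"]
      by (simp add: power2_eq_square algebra_simps)
    moreover have "0 \<le> cmod (ell2_fun f x) * cmod (ell2_fun g x)" by simp
    ultimately show ?thesis by (simp only: norm_mult complex_mod_cnj)
  qed
qed simp

definition cinner :: "'x ell2 \<Rightarrow> 'x ell2 \<Rightarrow> complex" where
  "cinner f g = (\<Sum>\<^sub>\<infinity>x. cnj (ell2_fun f x) * ell2_fun g x)"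

instantiation ell2 :: (type) "{real_vector, scaleC}"
begin
lift_definition zero_ell2 :: "'a ell2" is "\<lambda>_. 0" by simp
lift_definition plus_ell2 :: "'a ell2 \<Rightarrow> 'a ell2 \<Rightarrow> 'a ell2" is "\<lambda>f g x. f x + g x"
  by (rule sq_summable_add)
lift_definition uminus_ell2 :: "'a ell2 \<Rightarrow> 'a ell2" is "\<lambda>f x. - f x" by simp
lift_definition minus_ell2 :: "'a ell2 \<Rightarrow> 'a ell2 \<Rightarrow> 'a ell2" is "\<lambda>f g x. f x - g x"
  subgoal for f g using sq_summable_add[of f "\<lambda>x. - g x"] by simp
  done
lift_definition scaleC_ell2 :: "complex \<Rightarrow> 'a ell2 \<Rightarrow> 'a ell2" is "\<lambda>c f x. c * f x"
  by (rule sq_summable_scale)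
definition scaleR_ell2 :: "real \<Rightarrow> 'a ell2 \<Rightarrow> 'a ell2" where
  "scaleR_ell2 r f = complex_of_real r *\<^sub>C f"
instance
  by standard (simp_all add: scaleR_ell2_def, (transfer; auto simp: algebra_simps)+)
end

lemma ell2_fun_simps [simp]:
  "ell2_fun 0 x = 0"
  "ell2_fun (f + g) x = ell2_fun f x + ell2_fun g x"
  "ell2_fun (f - g) x = ell2_fun f x - ell2_fun g x"
  "ell2_fun (- f) x = - ell2_fun f x"
  "ell2_fun (c *\<^sub>C f) x = c * ell2_fun f x"
  "ell2_fun (r *\<^sub>R f) x = r *\<^sub>R ell2_fun f x"
  by (simp_all add: zero_ell2.rep_eq plus_ell2.rep_eq minus_ell2.rep_eq uminus_ell2.rep_eq
      scaleC_ell2.rep_eq scaleR_ell2_def scaleR_conv_of_real)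

lemma cinner_add_right: "cinner f (g + h) = cinner f g + cinner f h"
  unfolding cinner_def
  by (simp add: distrib_left infsum_add[OF ell2_prod_summable ell2_prod_summable])

lemma cinner_zero [simp]: "cinner 0 f = 0" "cinner f 0 = 0"
  by (simp_all add: cinner_def)

lemma cinner_scaleC_right: "cinner f (c *\<^sub>C g) = c * cinner f g"
  unfolding cinner_def
  by (simp add: mult.left_commute[of _ c] infsum_cmult_right')

lemma cinner_commute: "cnj (cinner f g) = cinner g f"
  unfolding cinner_def infsum_cnj[symmetric] by (simp add: mult.commute)

lemma cinner_add_left: "cinner (f + g) h = cinner f h + cinner g h"
  by (metis cinner_add_right cinner_commute complex_cnj_add)

lemma cinner_scaleC_left: "cinner (c *\<^sub>C f) g = cnj c * cinner f g"
  by (metis cinner_scaleC_right cinner_commute complex_cnj_mult)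

lemma cinner_self: "cinner f f = complex_of_real (\<Sum>\<^sub>\<infinity>x. (cmod (ell2_fun f x))\<^sup>2)"
proof -
  have "((\<lambda>x. complex_of_real ((cmod (ell2_fun f x))\<^sup>2)) has_sum
      complex_of_real (\<Sum>\<^sub>\<infinity>x. (cmod (ell2_fun f x))\<^sup>2)) UNIV"
    by (intro has_sum_of_real has_sum_infsum ell2_summable)
  moreover have "cnj (ell2_fun f x) * ell2_fun f x = complex_of_real ((cmod (ell2_fun f x))\<^sup>2)" for x
    by (simp only: complex_norm_square mult.commute)
  ultimately show ?thesis unfolding cinner_def by (simp only: infsumI)
qed

instantiation ell2 :: (type) real_inner
begin
definition inner_ell2 :: "'a ell2 \<Rightarrow> 'a ell2 \<Rightarrow> real" where "inner_ell2 f g = Re (cinner f g)"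
definition norm_ell2 :: "'a ell2 \<Rightarrow> real" where "norm_ell2 f = sqrt (inner f f)"
definition sgn_ell2 :: "'a ell2 \<Rightarrow> 'a ell2" where "sgn_ell2 f = f /\<^sub>R norm f"
definition dist_ell2 :: "'a ell2 \<Rightarrow> 'a ell2 \<Rightarrow> real" where "dist_ell2 f g = norm (f - g)"
definition uniformity_ell2 :: "('a ell2 \<times> 'a ell2) filter" where
  "uniformity_ell2 = (INF e\<in>{0<..}. principal {(x, y). dist x y < e})"
definition open_ell2 :: "'a ell2 set \<Rightarrow> bool" where
  "open_ell2 U = (\<forall>x\<in>U. \<forall>\<^sub>F (x', y) in uniformity. x' = x \<longrightarrow> y \<in> U)"
instance
proof
  fix f g h :: "'a ell2" and r :: real and U :: "'a ell2 set"
  show "inner f g = inner g f"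
    unfolding inner_ell2_def by (subst cinner_commute[symmetric]) simp
  show "inner (f + g) h = inner f h + inner g h" by (simp add: inner_ell2_def cinner_add_left)
  show "inner (r *\<^sub>R f) g = r * inner f g"
    by (simp add: inner_ell2_def scaleR_ell2_def cinner_scaleC_left)
  show "0 \<le> inner f f" by (simp add: inner_ell2_def cinner_self infsum_nonneg)
  show "(inner f f = 0) = (f = 0)"
  proof
    assume "inner f f = 0"
    hence "(\<Sum>\<^sub>\<infinity>x. (cmod (ell2_fun f x))\<^sup>2) = 0" by (simp add: inner_ell2_def cinner_self)
    hence "(cmod (ell2_fun f x))\<^sup>2 = 0" for x
      by (intro nonneg_infsum_le_0D[where A=UNIV and f="\<lambda>x. (cmod (ell2_fun f x))\<^sup>2"])
        (auto intro: ell2_summable)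
    thus "f = 0" by (intro ell2_eqI) simp
  next
    assume "f = 0" thus "inner f f = 0" by (simp add: inner_ell2_def cinner_self)
  qed
qed (simp_all add: norm_ell2_def sgn_ell2_def dist_ell2_def uniformity_ell2_def open_ell2_def)
end

lemma norm_ell2_sq: "(norm f)\<^sup>2 = (\<Sum>\<^sub>\<infinity>x. (cmod (ell2_fun f x))\<^sup>2)"
  by (simp add: norm_ell2_def inner_ell2_def cinner_self infsum_nonneg)

lemma ell2_finite_sum_le: "finite F \<Longrightarrow> (\<Sum>x\<in>F. (cmod (ell2_fun f x))\<^sup>2) \<le> (norm f)\<^sup>2"
  unfolding norm_ell2_sq by (rule finite_sum_le_infsum[OF ell2_summable]) auto

lemma ell2_cmod_le: "cmod (ell2_fun f x) \<le> norm f"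
  using ell2_finite_sum_le[of "{x}" f] by (simp add: abs_le_square_iff[symmetric])

lemma sq_summable_bounded:
  fixes g :: "'x \<Rightarrow> complex"
  assumes "\<And>F. finite F \<Longrightarrow> (\<Sum>x\<in>F. (cmod (g x))\<^sup>2) \<le> B"
  shows "(\<lambda>x. (cmod (g x))\<^sup>2) summable_on UNIV"
  by (rule nonneg_bdd_above_summable_on) (use assms in \<open>auto intro!: bdd_aboveI[of _ B]\<close>)

lemma norm_ell2_le:
  assumes "\<And>F. finite F \<Longrightarrow> (\<Sum>x\<in>F. (cmod (ell2_fun f x))\<^sup>2) \<le> B\<^sup>2" "0 \<le> B"
  shows "norm f \<le> B"
proof -
  have "(norm f)\<^sup>2 \<le> B\<^sup>2"
    unfolding norm_ell2_sq by (rule infsum_le_finite_sums[OF ell2_summable]) (use assms in auto)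
  thus ?thesis using assms(2) by (simp add: power2_le_iff_abs_le)
qed

instance ell2 :: (type) banach
proof
  fix X :: "nat \<Rightarrow> 'a ell2"
  assume X: "Cauchy X"
  have "Cauchy (\<lambda>n. ell2_fun (X n) x)" for x
  proof (rule metric_CauchyI)
    fix e :: real assume "0 < e"
    then obtain M where M: "\<And>m n. m \<ge> M \<Longrightarrow> n \<ge> M \<Longrightarrow> norm (X m - X n) < e"
      using X unfolding Cauchy_iff by blast
    show "\<exists>M. \<forall>m\<ge>M. \<forall>n\<ge>M. dist (ell2_fun (X m) x) (ell2_fun (X n) x) < e"
    proof (intro exI allI impI)
      fix m n assume "M \<le> m" "M \<le> n"
      have "dist (ell2_fun (X m) x) (ell2_fun (X n) x) = cmod (ell2_fun (X m - X n) x)"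
        by (simp add: dist_norm)
      also have "\<dots> \<le> norm (X m - X n)" by (rule ell2_cmod_le)
      also have "\<dots> < e" by (rule M[OF \<open>M \<le> m\<close> \<open>M \<le> n\<close>])
      finally show "dist (ell2_fun (X m) x) (ell2_fun (X n) x) < e" .
    qed
  qed
  hence "\<forall>x. \<exists>l. (\<lambda>n. ell2_fun (X n) x) \<longlonglongrightarrow> l"
    unfolding convergent_def[symmetric] Cauchy_convergent_iff[symmetric] by (rule allI)
  then obtain g where g: "\<And>x. (\<lambda>n. ell2_fun (X n) x) \<longlonglongrightarrow> g x"
    by (auto simp: choice_iff)
  have bd: "(\<Sum>x\<in>F. (cmod (ell2_fun (X n) x - g x))\<^sup>2) \<le> e\<^sup>2"
    if M: "\<And>m n. m \<ge> M \<Longrightarrow> n \<ge> M \<Longrightarrow> norm (X m - X n) < e" and "M \<le> n" "finite F" for e M n F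
  proof (rule tendsto_upperbound)
    show "(\<lambda>m. \<Sum>x\<in>F. (cmod (ell2_fun (X n) x - ell2_fun (X m) x))\<^sup>2)
        \<longlonglongrightarrow> (\<Sum>x\<in>F. (cmod (ell2_fun (X n) x - g x))\<^sup>2)"
      by (intro tendsto_intros g)
    show "\<forall>\<^sub>F m in sequentially. (\<Sum>x\<in>F. (cmod (ell2_fun (X n) x - ell2_fun (X m) x))\<^sup>2) \<le> e\<^sup>2"
    proof (rule eventually_sequentiallyI)
      fix m assume "M \<le> m"
      have "(\<Sum>x\<in>F. (cmod (ell2_fun (X n) x - ell2_fun (X m) x))\<^sup>2) \<le> (norm (X n - X m))\<^sup>2"
        using ell2_finite_sum_le[OF \<open>finite F\<close>, of "X n - X m"] by simp
      also have "\<dots> \<le> e\<^sup>2"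
        using M[OF \<open>M \<le> n\<close> \<open>M \<le> m\<close>] by (intro power_mono) auto
      finally show "(\<Sum>x\<in>F. (cmod (ell2_fun (X n) x - ell2_fun (X m) x))\<^sup>2) \<le> e\<^sup>2" .
    qed
  qed simp
  obtain M where M: "\<And>m n. m \<ge> M \<Longrightarrow> n \<ge> M \<Longrightarrow> norm (X m - X n) < 1"
    using X unfolding Cauchy_iff by (metis zero_less_one)
  have "(\<lambda>x. (cmod (ell2_fun (X M) x - g x))\<^sup>2) summable_on UNIV"
    by (rule sq_summable_bounded[where B="1\<^sup>2"]) (rule bd[OF M order_refl])
  from sq_summable_add[OF sq_summable_scale[OF this, of "-1"] ell2_summable[of "X M"]]
  have sg: "(\<lambda>x. (cmod (g x))\<^sup>2) summable_on UNIV" by simp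
  define G where "G = Abs_ell2 g"
  have G: "ell2_fun G = g" unfolding G_def using sg by (simp add: Abs_ell2_inverse)
  have "X \<longlonglongrightarrow> G"
  proof (rule metric_LIMSEQ_I)
    fix e :: real assume "0 < e"
    then obtain M where M: "\<And>m n. m \<ge> M \<Longrightarrow> n \<ge> M \<Longrightarrow> norm (X m - X n) < e / 2"
      using X unfolding Cauchy_iff by (metis half_gt_zero)
    show "\<exists>M. \<forall>n\<ge>M. dist (X n) G < e"
    proof (intro exI allI impI)
      fix n assume "M \<le> n"
      have "norm (X n - G) \<le> e / 2"
        by (rule norm_ell2_le) (use bd[OF M \<open>M \<le> n\<close>] \<open>0 < e\<close> in \<open>simp_all add: G\<close>)
      thus "dist (X n) G < e" using \<open>0 < e\<close> by (simp add: dist_norm)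
    qed
  qed
  thus "convergent X" unfolding convergent_def by blast
qed

lemma norm_scaleC_ell2: "norm (c *\<^sub>C (f :: 'x ell2)) = cmod c * norm f"
proof -
  have "(norm (c *\<^sub>C f))\<^sup>2 = (cmod c * norm f)\<^sup>2"
    by (simp add: norm_ell2_sq norm_mult power_mult_distrib infsum_cmult_right')
  thus ?thesis by (simp add: power2_eq_iff_nonneg)
qed

section \<open>Bounded complex-linear operators\<close>

text \<open>\<^typ>\<open>'x ell2 \<Rightarrow>\<^sub>L 'x ell2\<close> consists of the bounded real-linear maps.\<close>

typedef 'x bop = "{T :: 'x ell2 \<Rightarrow>\<^sub>L 'x ell2. \<forall>c \<psi>. T (c *\<^sub>C \<psi>) = c *\<^sub>C T \<psi>}"
  morphisms bop_blinfun Abs_bop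
  by (rule exI[of _ 0]) (auto intro: ell2_eqI)

setup_lifting type_definition_bop

definition bop_apply :: "'x bop \<Rightarrow> 'x ell2 \<Rightarrow> 'x ell2" (infixr "\<cdot>" 74) where
  "T \<cdot> \<psi> = blinfun_apply (bop_blinfun T) \<psi>"

lemma scaleC_ell2_laws:
  fixes f g :: "'x ell2"
  shows "c *\<^sub>C (f + g) = c *\<^sub>C f + c *\<^sub>C g" "c *\<^sub>C (f - g) = c *\<^sub>C f - c *\<^sub>C g"
    "c *\<^sub>C (- f) = - (c *\<^sub>C f)" "c *\<^sub>C (d *\<^sub>C f) = (c * d) *\<^sub>C f" "(c + d) *\<^sub>C f = c *\<^sub>C f + d *\<^sub>C f"
    "c *\<^sub>C (r *\<^sub>R f) = r *\<^sub>R (c *\<^sub>C f)" "c *\<^sub>C (0 :: 'x ell2) = 0" "1 *\<^sub>C f = f"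
    "r *\<^sub>R f = complex_of_real r *\<^sub>C f"
  by (auto intro!: ell2_eqI simp: algebra_simps scaleR_conv_of_real)

lemma bounded_linear_scaleC_ell2: "bounded_linear (\<lambda>f :: 'x ell2. c *\<^sub>C f)"
  by (rule bounded_linear_intro[where K="cmod c"])
    (auto simp: scaleC_ell2_laws(1,6) norm_scaleC_ell2)

instantiation bop :: (type) "{real_normed_algebra_1, scaleC}"
begin
lift_definition zero_bop :: "'a bop" is 0 by (auto simp: scaleC_ell2_laws)
lift_definition one_bop :: "'a bop" is id_blinfun by auto
lift_definition plus_bop :: "'a bop \<Rightarrow> 'a bop \<Rightarrow> 'a bop" is "(+)"
  by (auto simp: scaleC_ell2_laws(1) plus_blinfun.rep_eq)
lift_definition minus_bop :: "'a bop \<Rightarrow> 'a bop \<Rightarrow> 'a bop" is "(-)"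
  by (auto simp: scaleC_ell2_laws(2) minus_blinfun.rep_eq)
lift_definition uminus_bop :: "'a bop \<Rightarrow> 'a bop" is uminus
  by (auto simp: scaleC_ell2_laws(3) uminus_blinfun.rep_eq)
lift_definition times_bop :: "'a bop \<Rightarrow> 'a bop \<Rightarrow> 'a bop" is "(o\<^sub>L)" by auto
lift_definition scaleR_bop :: "real \<Rightarrow> 'a bop \<Rightarrow> 'a bop" is scaleR
  by (auto simp: scaleC_ell2_laws(6) scaleR_blinfun.rep_eq)
lift_definition scaleC_bop :: "complex \<Rightarrow> 'a bop \<Rightarrow> 'a bop" is
  "\<lambda>c T. Blinfun (\<lambda>\<psi>. c *\<^sub>C \<psi>) o\<^sub>L T"
  by (auto simp: bounded_linear_Blinfun_apply bounded_linear_scaleC_ell2 scaleC_ell2_laws(4) mult.commute)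
lift_definition norm_bop :: "'a bop \<Rightarrow> real" is norm .
definition sgn_bop :: "'a bop \<Rightarrow> 'a bop" where "sgn_bop T = scaleR (inverse (norm T)) T"
definition dist_bop :: "'a bop \<Rightarrow> 'a bop \<Rightarrow> real" where "dist_bop S T = norm (S - T)"
definition uniformity_bop :: "('a bop \<times> 'a bop) filter" where
  "uniformity_bop = (INF e\<in>{0<..}. principal {(x, y). dist x y < e})"
definition open_bop :: "'a bop set \<Rightarrow> bool" where
  "open_bop U = (\<forall>x\<in>U. \<forall>\<^sub>F (x', y) in uniformity. x' = x \<longrightarrow> y \<in> U)"
lemma ell2_nontrivial: "\<exists>f :: 'x ell2. f \<noteq> 0"
proof -
  define f :: "'x ell2" where "f = Abs_ell2 (\<lambda>x. if x = undefined then 1 else 0)"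
  have "(\<lambda>x. (cmod (if x = undefined then 1 else 0))\<^sup>2) summable_on (UNIV :: 'x set)"
    by (rule finite_nonzero_values_imp_summable_on) (rule finite_subset[of _ "{undefined}"], auto)
  hence "ell2_fun f undefined = 1" unfolding f_def by (subst Abs_ell2_inverse) auto
  thus ?thesis by (intro exI[of _ f]) auto
qed
instance
proof
  fix R S T :: "'a bop" and a b :: real and U :: "'a bop set"
  show "R + S + T = R + (S + T)" "R + S = S + R" "0 + R = R" "- R + R = 0" "R - S = R + - S"
    "a *\<^sub>R (R + S) = a *\<^sub>R R + a *\<^sub>R S" "(a + b) *\<^sub>R R = a *\<^sub>R R + b *\<^sub>R R" "a *\<^sub>R b *\<^sub>R R = (a * b) *\<^sub>R R"
    "1 *\<^sub>R R = R" "norm (R * S) \<le> norm R * norm S"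
    by (transfer; simp add: algebra_simps norm_blinfun_compose)+
  show "R * S * T = R * (S * T)" "(R + S) * T = R * T + S * T" "R * (S + T) = R * S + R * T"
    "a *\<^sub>R R * S = a *\<^sub>R (R * S)" "R * a *\<^sub>R S = a *\<^sub>R (R * S)" "1 * R = R" "R * 1 = R"
    by (transfer; rule blinfun_eqI; simp add: blinfun.bilinear_simps)+
  have nz: "\<exists>x :: 'a ell2. x \<noteq> 0" by (rule ell2_nontrivial)
  have "norm (id_blinfun :: 'a ell2 \<Rightarrow>\<^sub>L 'a ell2) = 1"
  proof -
    obtain x :: "'a ell2" where x: "x \<noteq> 0" using nz by blast
    have "norm x \<le> norm (id_blinfun :: 'a ell2 \<Rightarrow>\<^sub>L 'a ell2) * norm x"
      using norm_blinfun[of "id_blinfun :: 'a ell2 \<Rightarrow>\<^sub>L 'a ell2" x] by simp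
    hence "1 \<le> norm (id_blinfun :: 'a ell2 \<Rightarrow>\<^sub>L 'a ell2)" using x by simp
    moreover have "norm (id_blinfun :: 'a ell2 \<Rightarrow>\<^sub>L 'a ell2) \<le> 1"
      by (rule norm_blinfun_bound) auto
    ultimately show ?thesis by simp
  qed
  thus n1: "norm (1 :: 'a bop) = 1" by transfer
  show "(0 :: 'a bop) \<noteq> 1"
  proof
    assume "(0 :: 'a bop) = 1"
    hence "norm (0 :: 'a bop) = 1" by (simp only: n1)
    thus False by transfer simp
  qed
  show "sgn R = scaleR (inverse (norm R)) R" "dist R S = norm (R - S)"
    by (simp_all add: sgn_bop_def dist_bop_def)
  show "uniformity = (INF e\<in>{0<..}. principal {(x :: 'a bop, y). dist x y < e})"
    by (rule uniformity_bop_def)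
  show "open U = (\<forall>x\<in>U. \<forall>\<^sub>F (x', y) in uniformity. x' = x \<longrightarrow> y \<in> U)" by (rule open_bop_def)
  show "(norm R = 0) = (R = 0)" "norm (R + S) \<le> norm R + norm S" "norm (a *\<^sub>R R) = \<bar>a\<bar> * norm R"
    by (transfer; simp add: norm_triangle_ineq)+
qed
end

lemma bop_apply_simps [simp]:
  fixes S T :: "'x bop"
  shows "0 \<cdot> \<psi> = 0" "1 \<cdot> \<psi> = \<psi>" "(S + T) \<cdot> \<psi> = S \<cdot> \<psi> + T \<cdot> \<psi>" "(S - T) \<cdot> \<psi> = S \<cdot> \<psi> - T \<cdot> \<psi>"
    "(- T) \<cdot> \<psi> = - (T \<cdot> \<psi>)" "(S * T) \<cdot> \<psi> = S \<cdot> T \<cdot> \<psi>" "(c *\<^sub>C T) \<cdot> \<psi> = c *\<^sub>C (T \<cdot> \<psi>)"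
    "(r *\<^sub>R T) \<cdot> \<psi> = r *\<^sub>R (T \<cdot> \<psi>)" "T \<cdot> (\<psi> + \<phi>) = T \<cdot> \<psi> + T \<cdot> \<phi>" "T \<cdot> (\<psi> - \<phi>) = T \<cdot> \<psi> - T \<cdot> \<phi>"
    "T \<cdot> (c *\<^sub>C \<psi>) = c *\<^sub>C (T \<cdot> \<psi>)" "T \<cdot> (r *\<^sub>R \<psi>) = r *\<^sub>R (T \<cdot> \<psi>)" "T \<cdot> 0 = 0"
  using bop_blinfun[of T]
  by (simp_all add: bop_apply_def zero_bop.rep_eq one_bop.rep_eq plus_bop.rep_eq minus_bop.rep_eq
      uminus_bop.rep_eq times_bop.rep_eq scaleC_bop.rep_eq scaleR_bop.rep_eq blinfun.bilinear_simps
      bounded_linear_Blinfun_apply bounded_linear_scaleC_ell2)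

lemma bop_eqI: "(\<And>\<psi>. S \<cdot> \<psi> = T \<cdot> \<psi>) \<Longrightarrow> S = T"
  by (metis bop_apply_def bop_blinfun_inject blinfun_eqI)

lemma norm_bop_apply: "norm (T \<cdot> \<psi>) \<le> norm T * norm \<psi>"
  unfolding bop_apply_def norm_bop.rep_eq by (rule norm_blinfun)

lemma norm_bop_bound: "0 \<le> K \<Longrightarrow> (\<And>\<psi>. norm (T \<cdot> \<psi>) \<le> K * norm \<psi>) \<Longrightarrow> norm T \<le> K"
  unfolding bop_apply_def norm_bop.rep_eq by (rule norm_blinfun_bound)

lemma ex_bop:
  assumes "\<And>\<psi> \<phi>. F (\<psi> + \<phi>) = F \<psi> + F \<phi>" "\<And>c \<psi>. F (c *\<^sub>C \<psi>) = c *\<^sub>C F \<psi>"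
    "\<And>\<psi>. norm (F \<psi>) \<le> K * norm \<psi>"
  shows "\<exists>T. \<forall>\<psi>. T \<cdot> \<psi> = F \<psi>"
proof -
  have bl: "bounded_linear F"
    by (rule bounded_linear_intro[where K=K])
      (use assms in \<open>auto simp: scaleC_ell2_laws(9) mult.commute\<close>)
  have "bop_blinfun (Abs_bop (Blinfun F)) = Blinfun F"
    by (rule Abs_bop_inverse) (use assms bl in \<open>auto simp: bounded_linear_Blinfun_apply\<close>)
  thus ?thesis
    by (intro exI[of _ "Abs_bop (Blinfun F)"]) (simp add: bop_apply_def bounded_linear_Blinfun_apply bl)
qed

instance bop :: (type) banach
proof
  fix X :: "nat \<Rightarrow> 'a bop"
  assume X: "Cauchy X"
  have "Cauchy (\<lambda>n. bop_blinfun (X n))"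
    using X unfolding Cauchy_iff norm_bop.rep_eq minus_bop.rep_eq .
  then obtain T where T: "(\<lambda>n. bop_blinfun (X n)) \<longlonglongrightarrow> T"
    by (auto simp: Cauchy_convergent_iff convergent_def)
  have "T (c *\<^sub>C \<psi>) = c *\<^sub>C T \<psi>" for c \<psi>
  proof (rule LIMSEQ_unique)
    show "(\<lambda>n. bop_blinfun (X n) (c *\<^sub>C \<psi>)) \<longlonglongrightarrow> T (c *\<^sub>C \<psi>)"
      by (intro tendsto_intros T)
    have "(\<lambda>n. c *\<^sub>C bop_blinfun (X n) \<psi>) \<longlonglongrightarrow> c *\<^sub>C T \<psi>"
      by (intro bounded_linear.tendsto[OF bounded_linear_scaleC_ell2] tendsto_intros T)
    moreover have "bop_blinfun (X n) (c *\<^sub>C \<psi>) = c *\<^sub>C bop_blinfun (X n) \<psi>" for n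
      using bop_blinfun[of "X n"] by simp
    ultimately show "(\<lambda>n. bop_blinfun (X n) (c *\<^sub>C \<psi>)) \<longlonglongrightarrow> c *\<^sub>C T \<psi>" by simp
  qed
  hence "bop_blinfun (Abs_bop T) = T" by (intro Abs_bop_inverse) auto
  hence "X \<longlonglongrightarrow> Abs_bop T"
    using T unfolding LIMSEQ_iff norm_bop.rep_eq minus_bop.rep_eq by simp
  thus "convergent X" unfolding convergent_def by blast
qed

lemma ell2_fun_Abs: "(\<And>F. finite F \<Longrightarrow> (\<Sum>x\<in>F. (cmod (g x))\<^sup>2) \<le> B) \<Longrightarrow> ell2_fun (Abs_ell2 g) = g"
  by (rule Abs_ell2_inverse) (auto intro: sq_summable_bounded)

definition ket :: "'x \<Rightarrow> 'x ell2" where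
  "ket x = Abs_ell2 (\<lambda>y. if y = x then 1 else 0)"

lemma ell2_fun_ket [simp]: "ell2_fun (ket x) y = (if y = x then 1 else 0)"
proof -
  have "(\<lambda>y. (cmod (if y = x then 1 else 0))\<^sup>2) summable_on UNIV"
    by (rule finite_nonzero_values_imp_summable_on) (rule finite_subset[of _ "{x}"], auto)
  thus ?thesis unfolding ket_def by (subst Abs_ell2_inverse) auto
qed

lemma ell2_fun_sum [simp]: "ell2_fun (\<Sum>i\<in>F. f i) x = (\<Sum>i\<in>F. ell2_fun (f i) x)"
  by (induction F rule: infinite_finite_induct) auto

lemma bop_apply_sum: "T \<cdot> (\<Sum>i\<in>F. f i) = (\<Sum>i\<in>F. T \<cdot> f i)"
  by (induction F rule: infinite_finite_induct) auto

lemma cinner_sum_left: "cinner (\<Sum>i\<in>F. f i) g = (\<Sum>i\<in>F. cinner (f i) g)"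
  by (induction F rule: infinite_finite_induct) (auto simp: cinner_add_left)

lemma cinner_ket [simp]: "cinner (ket x) f = ell2_fun f x"
proof -
  have "((\<lambda>y. cnj (ell2_fun (ket x) y) * ell2_fun f y) has_sum ell2_fun f x) UNIV"
    by (rule has_sum_finite_neutralI[of "{x}"]) auto
  thus ?thesis unfolding cinner_def by (rule infsumI)
qed

lemma cinner_ket_right: "cinner f (ket x) = cnj (ell2_fun f x)"
  by (metis cinner_commute cinner_ket)

lemma cinner_diff_right: "cinner f (g - h) = cinner f g - cinner f h"
  using cinner_add_right[of f "g - h" h] by simp

lemma cinner_diff_left: "cinner (f - g) h = cinner f h - cinner g h"
  using cinner_add_left[of "f - g" g h] by simp

lemma cmod_cinner_le: "cmod (cinner f g) \<le> norm f * norm g"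
proof -
  define c where "c = cnj (sgn (cinner f g))"
  have "complex_of_real (cmod (cinner f g)) = c * cinner f g"
    unfolding c_def sgn_div_norm
    by (cases "cinner f g = 0")
      (simp_all add: scaleR_conv_of_real mult.commute[of "cnj _"] complex_norm_square[symmetric]
        field_simps power2_eq_square flip: of_real_mult)
  hence "cmod (cinner f g) = Re (cinner f (c *\<^sub>C g))"
    by (metis Re_complex_of_real cinner_scaleC_right)
  also have "\<dots> = inner f (c *\<^sub>C g)" by (simp add: inner_ell2_def)
  also have "\<dots> \<le> norm f * norm (c *\<^sub>C g)" by (rule norm_cauchy_schwarz)
  also have "\<dots> \<le> norm f * norm g"
    unfolding norm_scaleC_ell2 c_def
    by (intro mult_left_mono mult_left_le_one_le) (auto simp: norm_sgn)
  finally show ?thesis .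
qed

lemma ell2_approx:
  assumes "0 < e"
  shows "\<exists>F. finite F \<and> norm (f - (\<Sum>x\<in>F. ell2_fun f x *\<^sub>C ket x)) < e"
proof -
  obtain F where F: "finite F"
    "dist (\<Sum>x\<in>F. (cmod (ell2_fun f x))\<^sup>2) (\<Sum>\<^sub>\<infinity>x. (cmod (ell2_fun f x))\<^sup>2) \<le> e\<^sup>2 / 2"
    using infsum_finite_approximation[OF ell2_summable[of f], of "e\<^sup>2 / 2"] assms by auto
  define g where "g = f - (\<Sum>x\<in>F. ell2_fun f x *\<^sub>C ket x)"
  have g: "ell2_fun g x = (if x \<in> F then 0 else ell2_fun f x)" for x
    using F(1) by (simp add: g_def if_distrib sum.delta cong: if_cong)
  have sF: "(\<lambda>x. (cmod (ell2_fun f x))\<^sup>2) summable_on (UNIV - F)"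
    by (rule summable_on_subset[OF ell2_summable]) auto
  have "(\<Sum>\<^sub>\<infinity>x. (cmod (ell2_fun f x))\<^sup>2)
      = (\<Sum>\<^sub>\<infinity>x\<in>F. (cmod (ell2_fun f x))\<^sup>2) + (\<Sum>\<^sub>\<infinity>x\<in>UNIV - F. (cmod (ell2_fun f x))\<^sup>2)"
    using infsum_Un_disjoint[of "\<lambda>x. (cmod (ell2_fun f x))\<^sup>2" F "UNIV - F"] F(1) sF by simp
  moreover have "(norm g)\<^sup>2 = (\<Sum>\<^sub>\<infinity>x\<in>UNIV - F. (cmod (ell2_fun f x))\<^sup>2)"
    unfolding norm_ell2_sq by (rule infsum_cong_neutral) (auto simp: g)
  ultimately have "(norm g)\<^sup>2 \<le> e\<^sup>2 / 2" using F by (simp add: dist_real_def)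
  also have "\<dots> < e\<^sup>2" using assms by simp
  finally have "norm g < e" using assms by (simp add: power2_less_imp_less)
  thus ?thesis using F(1) g_def by blast
qed

lemma bop_ket_eqI:
  assumes "\<And>x. S \<cdot> ket x = T \<cdot> ket x"
  shows "S = T"
proof (rule bop_eqI)
  fix \<psi>
  have "norm ((S - T) \<cdot> \<psi>) \<le> e" if "0 < e" for e
  proof -
    have "0 < e / (norm (S - T) + 1)" using that by (simp add: add_nonneg_pos)
    from ell2_approx[OF this, of \<psi>] obtain F where
      F: "norm (\<psi> - (\<Sum>x\<in>F. ell2_fun \<psi> x *\<^sub>C ket x)) < e / (norm (S - T) + 1)" by blast
    have "(S - T) \<cdot> (\<Sum>x\<in>F. ell2_fun \<psi> x *\<^sub>C ket x) = 0"
      by (simp add: bop_apply_sum assms scaleC_ell2_laws(7))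
    hence "norm ((S - T) \<cdot> \<psi>) = norm ((S - T) \<cdot> (\<psi> - (\<Sum>x\<in>F. ell2_fun \<psi> x *\<^sub>C ket x)))"
      by (simp only: bop_apply_simps(10) diff_zero)
    also have "\<dots> \<le> norm (S - T) * norm (\<psi> - (\<Sum>x\<in>F. ell2_fun \<psi> x *\<^sub>C ket x))"
      by (rule norm_bop_apply)
    also have "\<dots> \<le> (norm (S - T) + 1) * (e / (norm (S - T) + 1))"
      using F by (intro mult_mono) auto
    also have "\<dots> = e" by (simp add: add_nonneg_eq_0_iff)
    finally show ?thesis .
  qed
  hence "norm ((S - T) \<cdot> \<psi>) \<le> 0" by (rule field_le_epsilon[of _ 0, simplified])
  thus "S \<cdot> \<psi> = T \<cdot> \<psi>" by simp
qed

subsection \<open>Adjoints\<close>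

definition adj :: "'x bop \<Rightarrow> 'x bop" where
  "adj T = (THE S. \<forall>\<psi> \<phi>. cinner (S \<cdot> \<psi>) \<phi> = cinner \<psi> (T \<cdot> \<phi>))"

lemma cinner_eqI: "(\<And>\<phi>. cinner \<psi> \<phi> = cinner \<psi>' \<phi>) \<Longrightarrow> \<psi> = \<psi>'"
  by (rule ell2_eqI) (metis cinner_ket cinner_commute)

lemma ex1_adj: "\<exists>!S :: 'x bop. \<forall>\<psi> \<phi>. cinner (S \<cdot> \<psi>) \<phi> = cinner \<psi> (T \<cdot> \<phi>)"
proof -
  define G where "G \<psi> x = cinner (T \<cdot> ket x) \<psi>" for \<psi> x
  have bd: "(\<Sum>x\<in>F. (cmod (G \<psi> x))\<^sup>2) \<le> (norm T * norm \<psi>)\<^sup>2" if "finite F" for F \<psi>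
  proof -
    define s where "s = (\<Sum>x\<in>F. (cmod (G \<psi> x))\<^sup>2)"
    define v where "v = (\<Sum>x\<in>F. G \<psi> x *\<^sub>C ket x)"
    have s0: "0 \<le> s" unfolding s_def by (rule sum_nonneg) simp
    have v: "ell2_fun v x = (if x \<in> F then G \<psi> x else 0)" for x
      using that by (simp add: v_def if_distrib sum.delta cong: if_cong)
    have "(norm v)\<^sup>2 = (\<Sum>\<^sub>\<infinity>x\<in>F. (cmod (G \<psi> x))\<^sup>2)"
      unfolding norm_ell2_sq by (rule infsum_cong_neutral) (auto simp: v)
    hence nv: "(norm v)\<^sup>2 = s" using that by (simp add: s_def)
    have "cinner (T \<cdot> v) \<psi> = (\<Sum>x\<in>F. cnj (G \<psi> x) * G \<psi> x)"
      by (simp add: v_def bop_apply_sum cinner_sum_left cinner_scaleC_left G_def)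
    also have "\<dots> = complex_of_real s"
      unfolding s_def of_real_sum by (simp only: complex_norm_square mult.commute)
    finally have "s = cmod (cinner (T \<cdot> v) \<psi>)" using s0 by simp
    also have "\<dots> \<le> norm (T \<cdot> v) * norm \<psi>" by (rule cmod_cinner_le)
    also have "\<dots> \<le> norm T * norm v * norm \<psi>" by (intro mult_right_mono norm_bop_apply) simp
    finally have le: "s \<le> norm v * (norm T * norm \<psi>)" by (simp add: algebra_simps)
    have "norm v \<le> norm T * norm \<psi>"
    proof (cases "norm v = 0")
      case False
      hence "0 < norm v" by simp
      thus ?thesis using le unfolding nv[symmetric] power2_eq_square by simp
    qed simp
    hence "(norm v)\<^sup>2 \<le> (norm T * norm \<psi>)\<^sup>2" by (intro power_mono) auto
    thus ?thesis using nv s_def by simp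
  qed
  define S where "S \<psi> = Abs_ell2 (G \<psi>)" for \<psi>
  have S: "ell2_fun (S \<psi>) x = G \<psi> x" for \<psi> x
    unfolding S_def by (subst ell2_fun_Abs[OF bd]) auto
  have "\<exists>S'. \<forall>\<psi>. S' \<cdot> \<psi> = S \<psi>"
  proof (rule ex_bop)
    show "norm (S \<psi>) \<le> norm T * norm \<psi>" for \<psi>
      by (rule norm_ell2_le) (use bd in \<open>auto simp: S\<close>)
  qed (auto intro!: ell2_eqI simp: S G_def cinner_add_right cinner_scaleC_right)
  then obtain S' where S': "\<And>\<psi>. S' \<cdot> \<psi> = S \<psi>" by blast
  have eq: "cinner (S' \<cdot> \<psi>) \<phi> = cinner \<psi> (T \<cdot> \<phi>)" for \<psi> \<phi>
  proof -
    have sum: "cinner (S' \<cdot> \<psi>) (\<Sum>x\<in>F. c x *\<^sub>C ket x) = cinner \<psi> (T \<cdot> (\<Sum>x\<in>F. c x *\<^sub>C ket x))" for F c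
    proof (induction F rule: infinite_finite_induct)
      case (insert x F)
      have "cinner (S' \<cdot> \<psi>) (ket x) = cinner \<psi> (T \<cdot> ket x)"
        by (simp add: cinner_ket_right S' S G_def cinner_commute)
      with insert show ?case by (simp add: cinner_add_right cinner_scaleC_right)
    qed simp_all
    define K where "K = norm (S' \<cdot> \<psi>) + norm \<psi> * norm T + 1"
    have K: "0 < K" unfolding K_def by (intro add_nonneg_pos add_nonneg_nonneg) auto
    have "cmod (cinner (S' \<cdot> \<psi>) \<phi> - cinner \<psi> (T \<cdot> \<phi>)) \<le> e" if "0 < e" for e
    proof -
      from ell2_approx[of "e / K" \<phi>] that K obtain F where
        F: "norm (\<phi> - (\<Sum>x\<in>F. ell2_fun \<phi> x *\<^sub>C ket x)) < e / K" by auto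
      define r where "r = \<phi> - (\<Sum>x\<in>F. ell2_fun \<phi> x *\<^sub>C ket x)"
      have "cinner (S' \<cdot> \<psi>) \<phi> - cinner \<psi> (T \<cdot> \<phi>) = cinner (S' \<cdot> \<psi>) r - cinner \<psi> (T \<cdot> r)"
        unfolding r_def by (simp add: cinner_diff_right sum)
      also have "cmod \<dots> \<le> norm (S' \<cdot> \<psi>) * norm r + norm \<psi> * norm (T \<cdot> r)"
        by (rule order_trans[OF norm_triangle_ineq4] add_mono cmod_cinner_le)+
      also have "\<dots> \<le> norm (S' \<cdot> \<psi>) * norm r + norm \<psi> * (norm T * norm r)"
        by (intro add_left_mono mult_left_mono norm_bop_apply) simp
      also have "\<dots> \<le> K * norm r" by (simp add: K_def algebra_simps)
      also have "\<dots> \<le> K * (e / K)" using F K by (intro mult_left_mono) (auto simp: r_def)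
      also have "\<dots> = e" using K by simp
      finally show ?thesis .
    qed
    hence "cmod (cinner (S' \<cdot> \<psi>) \<phi> - cinner \<psi> (T \<cdot> \<phi>)) \<le> 0"
      by (rule field_le_epsilon[of _ 0, simplified])
    thus ?thesis by simp
  qed
  show ?thesis
  proof (rule ex1I[of _ S'])
    fix R :: "'x bop" assume R: "\<forall>\<psi> \<phi>. cinner (R \<cdot> \<psi>) \<phi> = cinner \<psi> (T \<cdot> \<phi>)"
    show "R = S'" by (intro bop_eqI cinner_eqI) (simp add: R eq)
  qed (simp add: eq)
qed

lemma cinner_adj: "cinner (adj T \<cdot> \<psi>) \<phi> = cinner \<psi> (T \<cdot> \<phi>)"
  using theI'[OF ex1_adj[of T]] unfolding adj_def by blast

lemma adj_eqI: "(\<And>\<psi> \<phi>. cinner (S \<cdot> \<psi>) \<phi> = cinner \<psi> (T \<cdot> \<phi>)) \<Longrightarrow> adj T = S"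
  using ex1_adj[of T] cinner_adj[of T] by blast

subsection \<open>Transport along injections\<close>

definition ell2_pull :: "('x \<Rightarrow> 'y) \<Rightarrow> 'y ell2 \<Rightarrow> 'x ell2" where
  "ell2_pull f \<psi> = Abs_ell2 (\<lambda>x. ell2_fun \<psi> (f x))"

definition ell2_push :: "('x \<Rightarrow> 'y) \<Rightarrow> 'x ell2 \<Rightarrow> 'y ell2" where
  "ell2_push f \<psi> = Abs_ell2 (\<lambda>y. if y \<in> range f then ell2_fun \<psi> (inv f y) else 0)"

definition bop_of :: "('x ell2 \<Rightarrow> 'x ell2) \<Rightarrow> 'x bop" where
  "bop_of F = (THE T. \<forall>\<psi>. T \<cdot> \<psi> = F \<psi>)"

text \<open>For injective \<open>f\<close>, the map \<open>ell2_push f\<close> is the isometry \<open>V\<close> with \<open>V e\<^sub>x = e\<^bsub>f x\<^esub>\<close>, and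
  \<open>ell2_pull f\<close> is \<open>V\<^sup>*\<close>; the following are \<open>V T V\<^sup>*\<close> and \<open>V\<^sup>* T V\<close>.\<close>

definition extend_op :: "('x \<Rightarrow> 'y) \<Rightarrow> 'x bop \<Rightarrow> 'y bop" where
  "extend_op f T = bop_of (\<lambda>\<psi>. ell2_push f (T \<cdot> ell2_pull f \<psi>))"

definition compress_op :: "('x \<Rightarrow> 'y) \<Rightarrow> 'y bop \<Rightarrow> 'x bop" where
  "compress_op f T = bop_of (\<lambda>\<psi>. ell2_pull f (T \<cdot> ell2_push f \<psi>))"

lemma ell2_pull_bound:
  assumes "inj f" "finite F"
  shows "(\<Sum>x\<in>F. (cmod (ell2_fun \<psi> (f x)))\<^sup>2) \<le> (norm \<psi>)\<^sup>2"
proof -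
  have "(\<Sum>x\<in>F. (cmod (ell2_fun \<psi> (f x)))\<^sup>2) = (\<Sum>y\<in>f ` F. (cmod (ell2_fun \<psi> y))\<^sup>2)"
    using assms(1) by (subst sum.reindex) (auto intro: inj_on_subset)
  also have "\<dots> \<le> (norm \<psi>)\<^sup>2" using assms(2) by (intro ell2_finite_sum_le) auto
  finally show ?thesis .
qed

lemma ell2_fun_pull: "inj f \<Longrightarrow> ell2_fun (ell2_pull f \<psi>) x = ell2_fun \<psi> (f x)"
  unfolding ell2_pull_def by (subst ell2_fun_Abs[OF ell2_pull_bound]) auto

lemma norm_ell2_pull: "inj f \<Longrightarrow> norm (ell2_pull f \<psi>) \<le> norm \<psi>"
  by (rule norm_ell2_le) (auto simp: ell2_fun_pull ell2_pull_bound)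

lemma ell2_push_bound:
  assumes "inj f" "finite F"
  shows "(\<Sum>y\<in>F. (cmod (if y \<in> range f then ell2_fun \<psi> (inv f y) else 0))\<^sup>2) \<le> (norm \<psi>)\<^sup>2"
proof -
  have "(\<Sum>y\<in>F. (cmod (if y \<in> range f then ell2_fun \<psi> (inv f y) else 0))\<^sup>2)
      = (\<Sum>y\<in>F \<inter> range f. (cmod (ell2_fun \<psi> (inv f y)))\<^sup>2)"
    using assms(2) by (intro sum.mono_neutral_cong_right) auto
  also have "\<dots> = (\<Sum>x\<in>inv f ` (F \<inter> range f). (cmod (ell2_fun \<psi> x))\<^sup>2)"
    by (subst sum.reindex) (auto intro!: inj_onI dest: inv_into_injective)
  also have "\<dots> \<le> (norm \<psi>)\<^sup>2" using assms(2) by (intro ell2_finite_sum_le) auto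
  finally show ?thesis .
qed

lemma ell2_fun_push:
  "inj f \<Longrightarrow> ell2_fun (ell2_push f \<psi>) y = (if y \<in> range f then ell2_fun \<psi> (inv f y) else 0)"
  unfolding ell2_push_def by (subst ell2_fun_Abs[OF ell2_push_bound]) auto

lemma norm_ell2_push: "inj f \<Longrightarrow> norm (ell2_push f \<psi>) \<le> norm \<psi>"
  by (rule norm_ell2_le) (use ell2_push_bound in \<open>auto simp: ell2_fun_push\<close>)

lemma bop_of_apply:
  assumes "\<And>\<psi> \<phi>. F (\<psi> + \<phi>) = F \<psi> + F \<phi>" "\<And>c \<psi>. F (c *\<^sub>C \<psi>) = c *\<^sub>C F \<psi>"
    "\<And>\<psi>. norm (F \<psi>) \<le> K * norm \<psi>"
  shows "bop_of F \<cdot> \<psi> = F \<psi>"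
proof -
  obtain T where T: "\<forall>\<psi>. T \<cdot> \<psi> = F \<psi>" using ex_bop[OF assms] by blast
  hence "bop_of F = T" unfolding bop_of_def by (intro the_equality) (auto intro: bop_eqI)
  thus ?thesis using T by simp
qed

lemma ell2_pull_linear:
  assumes "inj f"
  shows "ell2_pull f (\<psi> + \<phi>) = ell2_pull f \<psi> + ell2_pull f \<phi>"
    "ell2_pull f (c *\<^sub>C \<psi>) = c *\<^sub>C ell2_pull f \<psi>"
  using assms by (auto intro!: ell2_eqI simp: ell2_fun_pull)

lemma ell2_push_linear:
  assumes "inj f"
  shows "ell2_push f (\<psi> + \<phi>) = ell2_push f \<psi> + ell2_push f \<phi>"
    "ell2_push f (c *\<^sub>C \<psi>) = c *\<^sub>C ell2_push f \<psi>"
  using assms by (auto intro!: ell2_eqI simp: ell2_fun_push)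

lemma extend_op_apply:
  assumes "inj f"
  shows "extend_op f T \<cdot> \<psi> = ell2_push f (T \<cdot> ell2_pull f \<psi>)"
  unfolding extend_op_def
proof (rule bop_of_apply[where K="norm T"])
  show "norm (ell2_push f (T \<cdot> ell2_pull f \<psi>)) \<le> norm T * norm \<psi>" for \<psi>
    by (rule order_trans[OF norm_ell2_push[OF assms] order_trans[OF norm_bop_apply]])
      (intro mult_left_mono norm_ell2_pull assms norm_ge_zero)
qed (simp_all add: assms ell2_pull_linear ell2_push_linear)

lemma compress_op_apply:
  assumes "inj f"
  shows "compress_op f T \<cdot> \<psi> = ell2_pull f (T \<cdot> ell2_push f \<psi>)"
  unfolding compress_op_def
proof (rule bop_of_apply[where K="norm T"])
  show "norm (ell2_pull f (T \<cdot> ell2_push f \<psi>)) \<le> norm T * norm \<psi>" for \<psi>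
    by (rule order_trans[OF norm_ell2_pull[OF assms] order_trans[OF norm_bop_apply]])
      (intro mult_left_mono norm_ell2_push assms norm_ge_zero)
qed (simp_all add: assms ell2_pull_linear ell2_push_linear)

subsection \<open>Block-diagonal operators and tensor products\<close>

text \<open>The Hilbert space direct sum of copies of \<open>\<ell>\<^sup>2(X)\<close> indexed by \<open>I\<close> is \<open>\<ell>\<^sup>2(I \<times> X)\<close>.\<close>

definition slice :: "'i \<Rightarrow> ('i \<times> 'x) ell2 \<Rightarrow> 'x ell2" where
  "slice i = ell2_pull (Pair i)"

definition block_diag :: "('i \<Rightarrow> 'x bop) \<Rightarrow> ('i \<times> 'x) bop" where
  "block_diag a = (THE T. \<forall>i \<psi>. slice i (T \<cdot> \<psi>) = a i \<cdot> slice i \<psi>)"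

lemma inj_Pair [simp]: "inj (Pair i)" by (auto intro: injI)

lemma ell2_fun_slice [simp]: "ell2_fun (slice i \<psi>) x = ell2_fun \<psi> (i, x)"
  by (simp add: slice_def ell2_fun_pull)

lemma slice_linear: "slice i (\<psi> + \<phi>) = slice i \<psi> + slice i \<phi>" "slice i (c *\<^sub>C \<psi>) = c *\<^sub>C slice i \<psi>"
  by (auto intro: ell2_eqI)

lemma sum_slice_le:
  fixes \<psi> :: "('i \<times> 'x) ell2"
  assumes "finite J"
  shows "(\<Sum>i\<in>J. (norm (slice i \<psi>))\<^sup>2) \<le> (norm \<psi>)\<^sup>2"
proof -
  have "((\<lambda>x. \<Sum>i\<in>J. (cmod (ell2_fun \<psi> (i, x)))\<^sup>2) has_sum (\<Sum>i\<in>J. (norm (slice i \<psi>))\<^sup>2)) UNIV"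
    using assms
  proof (induction J)
    case (insert i J)
    have "((\<lambda>x. (cmod (ell2_fun \<psi> (i, x)))\<^sup>2) has_sum (norm (slice i \<psi>))\<^sup>2) UNIV"
      unfolding norm_ell2_sq using has_sum_infsum[OF ell2_summable[of "slice i \<psi>"]] by simp
    from has_sum_add[OF this insert.IH] insert.hyps show ?case by simp
  qed simp
  thus ?thesis
  proof (rule has_sum_le_finite_sums)
    fix G :: "'x set" assume "finite G"
    have "(\<Sum>x\<in>G. \<Sum>i\<in>J. (cmod (ell2_fun \<psi> (i, x)))\<^sup>2) = (\<Sum>p\<in>J \<times> G. (cmod (ell2_fun \<psi> p))\<^sup>2)"
      by (subst sum.swap) (simp add: sum.cartesian_product)
    also have "\<dots> \<le> (norm \<psi>)\<^sup>2" using \<open>finite G\<close> assms by (intro ell2_finite_sum_le) auto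
    finally show "(\<Sum>x\<in>G. \<Sum>i\<in>J. (cmod (ell2_fun \<psi> (i, x)))\<^sup>2) \<le> (norm \<psi>)\<^sup>2" .
  qed
qed

lemma ex1_block_diag:
  fixes a :: "'i \<Rightarrow> 'x bop"
  assumes K: "\<And>i. norm (a i) \<le> K"
  shows "\<exists>!T. \<forall>i \<psi>. slice i (T \<cdot> \<psi>) = a i \<cdot> slice i \<psi>"
proof -
  have K0: "0 \<le> K" using K[of undefined] norm_ge_zero order_trans by blast
  define G where "G \<psi> p = ell2_fun (a (fst p) \<cdot> slice (fst p) \<psi>) (snd p)" for \<psi> p
  have bd: "(\<Sum>p\<in>F. (cmod (G \<psi> p))\<^sup>2) \<le> (K * norm \<psi>)\<^sup>2" if "finite F" for \<psi> F
  proof -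
    have "(\<Sum>p\<in>F. (cmod (G \<psi> p))\<^sup>2) \<le> (\<Sum>p\<in>fst ` F \<times> snd ` F. (cmod (G \<psi> p))\<^sup>2)"
      using that by (intro sum_mono2) (force simp: image_iff)+
    also have "\<dots> = (\<Sum>i\<in>fst ` F. \<Sum>x\<in>snd ` F. (cmod (ell2_fun (a i \<cdot> slice i \<psi>) x))\<^sup>2)"
      by (simp add: sum.cartesian_product G_def case_prod_beta)
    also have "\<dots> \<le> (\<Sum>i\<in>fst ` F. (norm (a i \<cdot> slice i \<psi>))\<^sup>2)"
      using that by (intro sum_mono ell2_finite_sum_le) auto
    also have "\<dots> \<le> (\<Sum>i\<in>fst ` F. (K * norm (slice i \<psi>))\<^sup>2)"
      by (intro sum_mono power_mono order_trans[OF norm_bop_apply] mult_right_mono K) auto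
    also have "\<dots> = K\<^sup>2 * (\<Sum>i\<in>fst ` F. (norm (slice i \<psi>))\<^sup>2)"
      by (simp add: power_mult_distrib sum_distrib_left)
    also have "\<dots> \<le> K\<^sup>2 * (norm \<psi>)\<^sup>2"
      using that by (intro mult_left_mono sum_slice_le) auto
    finally show ?thesis by (simp add: power_mult_distrib)
  qed
  define S where "S \<psi> = Abs_ell2 (G \<psi>)" for \<psi>
  have S: "ell2_fun (S \<psi>) p = G \<psi> p" for \<psi> p
    unfolding S_def by (subst ell2_fun_Abs[OF bd]) auto
  have "\<exists>T. \<forall>\<psi>. T \<cdot> \<psi> = S \<psi>"
  proof (rule ex_bop)
    show "norm (S \<psi>) \<le> K * norm \<psi>" for \<psi>
      by (rule norm_ell2_le) (use bd K0 in \<open>auto simp: S\<close>)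
  qed (auto intro!: ell2_eqI simp: S G_def slice_linear)
  then obtain T where T: "\<And>\<psi>. T \<cdot> \<psi> = S \<psi>" by blast
  show ?thesis
  proof (rule ex1I[of _ T])
    show "\<forall>i \<psi>. slice i (T \<cdot> \<psi>) = a i \<cdot> slice i \<psi>"
      by (auto intro!: ell2_eqI simp: T S G_def)
    fix R assume R: "\<forall>i \<psi>. slice i (R \<cdot> \<psi>) = a i \<cdot> slice i \<psi>"
    show "R = T"
    proof (intro bop_eqI ell2_eqI)
      fix \<psi> and p :: "'i \<times> 'x"
      have "ell2_fun (slice (fst p) (R \<cdot> \<psi>)) (snd p) = ell2_fun (a (fst p) \<cdot> slice (fst p) \<psi>) (snd p)"
        using R by simp
      thus "ell2_fun (R \<cdot> \<psi>) p = ell2_fun (T \<cdot> \<psi>) p" by (simp add: T S G_def)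
    qed
  qed
qed

lemma slice_block_diag: "(\<And>i. norm (a i) \<le> K) \<Longrightarrow> slice i (block_diag a \<cdot> \<psi>) = a i \<cdot> slice i \<psi>"
  using theI'[OF ex1_block_diag[of a K]] unfolding block_diag_def by blast

definition tensor_ell2 :: "'x ell2 \<Rightarrow> 'y ell2 \<Rightarrow> ('x \<times> 'y) ell2" (infixr "\<otimes>\<^sub>v" 70) where
  "\<psi> \<otimes>\<^sub>v \<phi> = Abs_ell2 (\<lambda>(x, y). ell2_fun \<psi> x * ell2_fun \<phi> y)"

definition tensor_op :: "'x bop \<Rightarrow> 'y bop \<Rightarrow> ('x \<times> 'y) bop" (infixr "\<otimes>\<^sub>o" 70) where
  "S \<otimes>\<^sub>o T = (THE U. \<forall>\<psi> \<phi>. U \<cdot> (\<psi> \<otimes>\<^sub>v \<phi>) = (S \<cdot> \<psi>) \<otimes>\<^sub>v (T \<cdot> \<phi>))"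

lemma ell2_fun_tensor [simp]: "ell2_fun (\<psi> \<otimes>\<^sub>v \<phi>) (x, y) = ell2_fun \<psi> x * ell2_fun \<phi> y"
proof -
  have "(\<Sum>p\<in>F. (cmod (case p of (x, y) \<Rightarrow> ell2_fun \<psi> x * ell2_fun \<phi> y))\<^sup>2) \<le> (norm \<psi> * norm \<phi>)\<^sup>2"
    if "finite F" for F
  proof -
    have "(\<Sum>p\<in>F. (cmod (case p of (x, y) \<Rightarrow> ell2_fun \<psi> x * ell2_fun \<phi> y))\<^sup>2)
        \<le> (\<Sum>p\<in>fst ` F \<times> snd ` F. (cmod (case p of (x, y) \<Rightarrow> ell2_fun \<psi> x * ell2_fun \<phi> y))\<^sup>2)"
      using that by (intro sum_mono2) (force simp: image_iff)+
    also have "\<dots> = (\<Sum>x\<in>fst ` F. (cmod (ell2_fun \<psi> x))\<^sup>2) * (\<Sum>y\<in>snd ` F. (cmod (ell2_fun \<phi> y))\<^sup>2)"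
      by (simp add: sum_product sum.cartesian_product case_prod_beta norm_mult power_mult_distrib)
    also have "\<dots> \<le> (norm \<psi>)\<^sup>2 * (norm \<phi>)\<^sup>2"
      using that by (intro mult_mono ell2_finite_sum_le) (auto intro: sum_nonneg)
    finally show ?thesis by (simp add: power_mult_distrib)
  qed
  thus ?thesis unfolding tensor_ell2_def by (subst ell2_fun_Abs) auto
qed

lemma ket_tensor: "ket x \<otimes>\<^sub>v ket y = ket (x, y)"
  by (rule ell2_eqI) (auto split: if_splits)

lemma ex1_tensor_op:
  fixes S :: "'x bop" and T :: "'y bop"
  shows "\<exists>!U. \<forall>\<psi> \<phi>. U \<cdot> (\<psi> \<otimes>\<^sub>v \<phi>) = (S \<cdot> \<psi>) \<otimes>\<^sub>v (T \<cdot> \<phi>)"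
proof -
  define sw :: "'x \<times> 'y \<Rightarrow> 'y \<times> 'x" where "sw = prod.swap"
  have sw: "inj sw" "range sw = UNIV" unfolding sw_def by auto
  have isw: "inv sw (y, x) = (x, y)" for x y
    using sw(1) by (intro inv_f_eq) (auto simp: sw_def)
  define U1 :: "('x \<times> 'y) bop" where "U1 = block_diag (\<lambda>_. T)"
  define U2 :: "('x \<times> 'y) bop" where "U2 = compress_op sw (block_diag (\<lambda>_. S))"
  have U1: "U1 \<cdot> (\<psi> \<otimes>\<^sub>v \<phi>) = \<psi> \<otimes>\<^sub>v (T \<cdot> \<phi>)" for \<psi> \<phi>
  proof (rule ell2_eqI)
    fix p :: "'x \<times> 'y"
    obtain x y where p: "p = (x, y)" by (cases p)
    have sl: "slice x (\<psi> \<otimes>\<^sub>v \<phi>) = ell2_fun \<psi> x *\<^sub>C \<phi>" by (rule ell2_eqI) simp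
    have "slice x (U1 \<cdot> (\<psi> \<otimes>\<^sub>v \<phi>)) = T \<cdot> slice x (\<psi> \<otimes>\<^sub>v \<phi>)"
      unfolding U1_def by (rule slice_block_diag[where K="norm T"]) simp
    hence "ell2_fun (slice x (U1 \<cdot> (\<psi> \<otimes>\<^sub>v \<phi>))) y = ell2_fun (T \<cdot> slice x (\<psi> \<otimes>\<^sub>v \<phi>)) y" by simp
    thus "ell2_fun (U1 \<cdot> (\<psi> \<otimes>\<^sub>v \<phi>)) p = ell2_fun (\<psi> \<otimes>\<^sub>v (T \<cdot> \<phi>)) p" by (simp add: p sl)
  qed
  have U2: "U2 \<cdot> (\<psi> \<otimes>\<^sub>v \<phi>) = (S \<cdot> \<psi>) \<otimes>\<^sub>v \<phi>" for \<psi> \<phi>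
  proof (rule ell2_eqI)
    fix p :: "'x \<times> 'y"
    obtain x y where p: "p = (x, y)" by (cases p)
    have sl: "slice y (ell2_push sw (\<psi> \<otimes>\<^sub>v \<phi>)) = ell2_fun \<phi> y *\<^sub>C \<psi>"
      by (rule ell2_eqI) (simp add: ell2_fun_push sw isw)
    have "slice y (block_diag (\<lambda>_. S) \<cdot> ell2_push sw (\<psi> \<otimes>\<^sub>v \<phi>)) = S \<cdot> slice y (ell2_push sw (\<psi> \<otimes>\<^sub>v \<phi>))"
      by (rule slice_block_diag[where K="norm S"]) simp
    hence "ell2_fun (slice y (block_diag (\<lambda>_. S) \<cdot> ell2_push sw (\<psi> \<otimes>\<^sub>v \<phi>))) x
        = ell2_fun (S \<cdot> slice y (ell2_push sw (\<psi> \<otimes>\<^sub>v \<phi>))) x" by simp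
    moreover have "sw (x, y) = (y, x)" by (simp add: sw_def)
    ultimately show "ell2_fun (U2 \<cdot> (\<psi> \<otimes>\<^sub>v \<phi>)) p = ell2_fun ((S \<cdot> \<psi>) \<otimes>\<^sub>v \<phi>) p"
      by (simp add: p sl U2_def compress_op_apply sw(1) ell2_fun_pull)
  qed
  show ?thesis
  proof (rule ex1I[of _ "U2 * U1"])
    show "\<forall>\<psi> \<phi>. (U2 * U1) \<cdot> (\<psi> \<otimes>\<^sub>v \<phi>) = (S \<cdot> \<psi>) \<otimes>\<^sub>v (T \<cdot> \<phi>)" by (simp add: U1 U2)
    fix R assume R: "\<forall>\<psi> \<phi>. R \<cdot> (\<psi> \<otimes>\<^sub>v \<phi>) = (S \<cdot> \<psi>) \<otimes>\<^sub>v (T \<cdot> \<phi>)"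
    show "R = U2 * U1"
    proof (rule bop_ket_eqI)
      fix p :: "'x \<times> 'y"
      show "R \<cdot> ket p = (U2 * U1) \<cdot> ket p"
        using R by (cases p) (simp add: ket_tensor[symmetric] U1 U2)
    qed
  qed
qed

lemma tensor_op_apply: "(S \<otimes>\<^sub>o T) \<cdot> (\<psi> \<otimes>\<^sub>v \<phi>) = (S \<cdot> \<psi>) \<otimes>\<^sub>v (T \<cdot> \<phi>)"
  using theI'[OF ex1_tensor_op[of S T]] unfolding tensor_op_def by blast

section \<open>C*-algebras of operators\<close>

text \<open>By the Gelfand--Naimark theorem every C*-algebra is, up to isomorphism, a norm-closed
  *-subalgebra of the bounded operators on some \<open>\<ell>\<^sup>2(X)\<close>. Such a subalgebra need not contain the
  identity operator, nor act nondegenerately.\<close>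

definition cstar_subalgebra :: "'x bop set \<Rightarrow> bool" where
  "cstar_subalgebra A \<longleftrightarrow> closed A \<and> 0 \<in> A \<and> (\<forall>x\<in>A. \<forall>y\<in>A. x + y \<in> A \<and> x * y \<in> A) \<and>
     (\<forall>c. \<forall>x\<in>A. c *\<^sub>C x \<in> A) \<and> (\<forall>x\<in>A. adj x \<in> A)"

definition cstar_generated :: "'x bop set \<Rightarrow> 'x bop set" where
  "cstar_generated X = \<Inter>{A. cstar_subalgebra A \<and> X \<subseteq> A}"

definition star_hom :: "'x bop set \<Rightarrow> 'y bop set \<Rightarrow> ('x bop \<Rightarrow> 'y bop) \<Rightarrow> bool" where
  "star_hom A B f \<longleftrightarrow> f ` A \<subseteq> B \<and> (\<forall>x\<in>A. \<forall>y\<in>A. f (x + y) = f x + f y \<and> f (x * y) = f x * f y) \<and>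
     (\<forall>c. \<forall>x\<in>A. f (c *\<^sub>C x) = c *\<^sub>C f x) \<and> (\<forall>x\<in>A. f (adj x) = adj (f x))"

text \<open>The minimal (spatial) tensor product: the norm closure of the algebraic tensor product in the
  bounded operators on the Hilbert space tensor product. It does not depend on the faithful
  representations in which \<open>A\<close> and \<open>B\<close> are given.\<close>

definition min_tensor :: "'x bop set \<Rightarrow> 'y bop set \<Rightarrow> ('x \<times> 'y) bop set" where
  "min_tensor A B = closure {\<Sum>k<N. a k \<otimes>\<^sub>o b k | (N :: nat) a b. \<forall>k<N. a k \<in> A \<and> b k \<in> B}"

text \<open>The flip \<open>x \<otimes> y \<mapsto> y \<otimes> x\<close>, implemented by the flip of the Hilbert space.\<close>

definition flip_op :: "('x \<times> 'x) bop \<Rightarrow> ('x \<times> 'x) bop" where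
  "flip_op = compress_op prod.swap"

lemma flip_op_tensor: "flip_op (S \<otimes>\<^sub>o T) = T \<otimes>\<^sub>o S"
proof (rule bop_ket_eqI)
  fix p :: "'a \<times> 'a"
  obtain x y where p: "p = (x, y)" by (cases p)
  have iswap: "inv prod.swap = (prod.swap :: 'a \<times> 'a \<Rightarrow> _)"
    by (rule inv_unique_comp) auto
  have push: "ell2_push prod.swap (\<psi> \<otimes>\<^sub>v \<phi>) = \<phi> \<otimes>\<^sub>v \<psi>" for \<psi> \<phi> :: "'a ell2"
    by (rule ell2_eqI) (auto simp: ell2_fun_push iswap)
  have pull: "ell2_pull prod.swap (\<psi> \<otimes>\<^sub>v \<phi>) = \<phi> \<otimes>\<^sub>v \<psi>" for \<psi> \<phi> :: "'a ell2"
    by (rule ell2_eqI) (auto simp: ell2_fun_pull)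
  show "flip_op (S \<otimes>\<^sub>o T) \<cdot> ket p = (T \<otimes>\<^sub>o S) \<cdot> ket p"
    by (simp add: p ket_tensor[symmetric] flip_op_def compress_op_apply push tensor_op_apply pull)
qed

text \<open>The C*-algebraic direct sum over \<open>N\<close>: families in the algebras \<open>A n\<close> whose norms vanish at
  infinity, acting block-diagonally.\<close>

definition c0_sum :: "nat set \<Rightarrow> (nat \<Rightarrow> 'x bop set) \<Rightarrow> (nat \<times> 'x) bop set" where
  "c0_sum N A = {block_diag a | a.
     (\<forall>n\<in>N. a n \<in> A n) \<and> (\<forall>n. n \<notin> N \<longrightarrow> a n = 0) \<and> (\<lambda>n. norm (a n)) \<longlonglongrightarrow> 0}"

subsection \<open>Multiplier algebras\<close>

text \<open>A multiplier \<open>X\<close> of \<open>B\<close> is given as the double centralizer \<open>(b \<mapsto> X b, b \<mapsto> b X)\<close>; linearity and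
  boundedness of the two maps follow from the centralizer identity.\<close>

type_synonym 'x multiplier = "('x bop \<Rightarrow> 'x bop) \<times> ('x bop \<Rightarrow> 'x bop)"

definition multipliers :: "'x bop set \<Rightarrow> 'x multiplier set" where
  "multipliers B = {(L, R). L \<in> B \<rightarrow>\<^sub>E B \<and> R \<in> B \<rightarrow>\<^sub>E B \<and> (\<forall>a\<in>B. \<forall>b\<in>B. a * L b = R a * b)}"

definition mult_one :: "'x bop set \<Rightarrow> 'x multiplier" where
  "mult_one B = (\<lambda>b\<in>B. b, \<lambda>b\<in>B. b)"

definition mult_times :: "'x bop set \<Rightarrow> 'x multiplier \<Rightarrow> 'x multiplier \<Rightarrow> 'x multiplier" where
  "mult_times B X Y = (\<lambda>b\<in>B. fst X (fst Y b), \<lambda>b\<in>B. snd Y (snd X b))"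

definition mult_adj :: "'x bop set \<Rightarrow> 'x multiplier \<Rightarrow> 'x multiplier" where
  "mult_adj B X = (\<lambda>b\<in>B. adj (snd X (adj b)), \<lambda>b\<in>B. adj (fst X (adj b)))"

definition mult_embed :: "'x bop set \<Rightarrow> 'x bop \<Rightarrow> 'x multiplier" where
  "mult_embed B c = (\<lambda>b\<in>B. c * b, \<lambda>b\<in>B. b * c)"

definition unitary_multiplier :: "'x bop set \<Rightarrow> 'x multiplier \<Rightarrow> bool" where
  "unitary_multiplier B X \<longleftrightarrow> X \<in> multipliers B \<and>
     mult_times B (mult_adj B X) X = mult_one B \<and> mult_times B X (mult_adj B X) = mult_one B"

subsection \<open>Universal R-matrices\<close>

definition mult_flip :: "'x bop set \<Rightarrow> ('x \<times> 'x) multiplier \<Rightarrow> ('x \<times> 'x) multiplier" where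
  "mult_flip A X = (\<lambda>b\<in>min_tensor A A. flip_op (fst X (flip_op b)),
                    \<lambda>b\<in>min_tensor A A. flip_op (snd X (flip_op b)))"

definition opposite_comult ::
    "'x bop set \<Rightarrow> ('x bop \<Rightarrow> ('x \<times> 'x) multiplier) \<Rightarrow> 'x bop \<Rightarrow> ('x \<times> 'x) multiplier" where
  "opposite_comult A \<Delta> x = mult_flip A (\<Delta> x)"

definition universal_R_matrix ::
    "'x bop set \<Rightarrow> ('x bop \<Rightarrow> ('x \<times> 'x) multiplier) \<Rightarrow> ('x \<times> 'x) multiplier \<Rightarrow> bool" where
  "universal_R_matrix A \<Delta> R \<longleftrightarrow> unitary_multiplier (min_tensor A A) R \<and>
     (\<forall>x\<in>A. mult_times (min_tensor A A) (mult_times (min_tensor A A) R (\<Delta> x))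
              (mult_adj (min_tensor A A) R) = opposite_comult A \<Delta> x)"

section \<open>The Cuntz algebras and their C*-bialgebra\<close>

text \<open>For \<open>n = 1\<close> the Cuntz relations only say that \<open>S 1\<close> is unitary; the convention \<open>\<O>\<^sub>1 = \<complex>\<close> with
  \<open>s\<^sub>1\<close> its unit is imposed by the last clause.\<close>

definition cuntz_family :: "nat \<Rightarrow> (nat \<Rightarrow> 'x bop) \<Rightarrow> bool" where
  "cuntz_family n S \<longleftrightarrow>
     (\<forall>i\<in>{1..n}. \<forall>j\<in>{1..n}. adj (S i) * S j = (if i = j then 1 else 0)) \<and>
     (\<Sum>i=1..n. S i * adj (S i)) = 1 \<and> (n = 1 \<longrightarrow> S 1 = 1)"

text \<open>The universal C*-algebra of the relations is formed as usual, as the C*-algebra generated by the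
  direct sum of all representations of the relations. It suffices to take those on \<open>\<ell>\<^sup>2(\<nat>)\<close>: a finitely
  generated C*-algebra is separable, hence acts faithfully and unitally on \<open>\<ell>\<^sup>2(\<nat>)\<close>. The index set
  consists of all sequences \<open>S\<close> of operators on \<open>\<ell>\<^sup>2(\<nat>)\<close>, of which only \<open>S 1, \<dots>, S n\<close> matter; the blocks
  of sequences that do not satisfy the relations are zero, so the unit of \<open>\<O>\<^sub>n\<close> is \<open>cuntz_unit n\<close> and
  not the identity operator.\<close>

type_synonym cuntz_index = "(nat \<Rightarrow> nat bop) \<times> nat"

definition cuntz_gen :: "nat \<Rightarrow> nat \<Rightarrow> cuntz_index bop" where
  "cuntz_gen n i = block_diag (\<lambda>S. if cuntz_family n S then S i else 0)"

definition cuntz_unit :: "nat \<Rightarrow> cuntz_index bop" where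
  "cuntz_unit n = block_diag (\<lambda>S. if cuntz_family n S then 1 else 0)"

definition cuntz_algebra :: "nat \<Rightarrow> cuntz_index bop set" where
  "cuntz_algebra n = cstar_generated (insert (cuntz_unit n) (cuntz_gen n ` {1..n}))"

definition cuntz_sum :: "(nat \<times> cuntz_index) bop set" where
  "cuntz_sum = c0_sum {1..} cuntz_algebra"

text \<open>The generators determine the values of \<open>cuntz_phi n m\<close> on \<open>\<O>\<^bsub>nm\<^esub>\<close>, and the existence of such a
  *-homomorphism is the universal property of \<open>\<O>\<^bsub>nm\<^esub>\<close>.  It is automatically injective.\<close>

definition cuntz_phi :: "nat \<Rightarrow> nat \<Rightarrow> cuntz_index bop \<Rightarrow> (cuntz_index \<times> cuntz_index) bop" where
  "cuntz_phi n m = (SOME f.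
     star_hom (cuntz_algebra (n * m)) (min_tensor (cuntz_algebra n) (cuntz_algebra m)) f \<and>
     f (cuntz_unit (n * m)) = cuntz_unit n \<otimes>\<^sub>o cuntz_unit m \<and>
     (\<forall>i\<in>{1..n}. \<forall>j\<in>{1..m}. f (cuntz_gen (n * m) (m * (i - 1) + j)) = cuntz_gen n i \<otimes>\<^sub>o cuntz_gen m j))"

text \<open>\<open>\<O>\<^sub>m \<otimes> \<O>\<^sub>l\<close> as a direct summand of \<open>\<O>\<^sub>* \<otimes> \<O>\<^sub>*\<close>.\<close>

definition summand_incl :: "nat \<Rightarrow> nat \<Rightarrow> (cuntz_index \<times> cuntz_index) bop \<Rightarrow>
    ((nat \<times> cuntz_index) \<times> (nat \<times> cuntz_index)) bop" where
  "summand_incl m l = extend_op (map_prod (Pair m) (Pair l))"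

definition cuntz_Delta_part :: "nat \<Rightarrow> cuntz_index bop \<Rightarrow>
    ((nat \<times> cuntz_index) \<times> (nat \<times> cuntz_index)) bop" where
  "cuntz_Delta_part n x =
     (\<Sum>(m, l)\<in>{(m, l). 1 \<le> m \<and> 1 \<le> l \<and> m * l = n}. summand_incl m l (cuntz_phi m l x))"

text \<open>The component of \<open>x\<close> in \<open>\<O>\<^sub>n\<close> is \<open>compress_op (Pair n) x\<close>. The term for \<open>n = 0\<close> is an empty sum.\<close>

definition cuntz_Delta :: "(nat \<times> cuntz_index) bop \<Rightarrow>
    ((nat \<times> cuntz_index) \<times> (nat \<times> cuntz_index)) bop" where
  "cuntz_Delta x = (\<Sum>n. cuntz_Delta_part n (compress_op (Pair n) x))"

definition cuntz_comult :: "(nat \<times> cuntz_index) bop \<Rightarrow>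
    ((nat \<times> cuntz_index) \<times> (nat \<times> cuntz_index)) multiplier" where
  "cuntz_comult x = mult_embed (min_tensor cuntz_sum cuntz_sum) (cuntz_Delta x)"

end

theory Submission
  imports Defs
begin

text \<open>
  Look only at the summand \<open>\<O>\<^sub>2 \<otimes> \<O>\<^sub>2\<close> and at \<open>x = s\<^sub>2\<close> in \<open>\<O>\<^sub>4\<close>, for which \<open>\<Delta>(x)\<close> has the component
  \<open>s\<^sub>1 \<otimes> s\<^sub>2\<close> and \<open>\<Delta>\<^sup>o\<^sup>p(x)\<close> the component \<open>s\<^sub>2 \<otimes> s\<^sub>1\<close>. Represent the left factor on \<open>\<ell>\<^sup>2(\<nat>)\<close> by
  \<open>s\<^sub>1 e\<^sub>k = e\<^bsub>2k\<^esub>\<close>, \<open>s\<^sub>2 e\<^sub>k = e\<^bsub>2k+1\<^esub>\<close> and the right factor by the same operators in the other order. Then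
  \<open>\<Omega> = e\<^sub>0 \<otimes> e\<^sub>0\<close> is fixed by \<open>s\<^sub>1 \<otimes> s\<^sub>2\<close>, so \<open>R \<Omega>\<close> would be a unit vector fixed by \<open>s\<^sub>2 \<otimes> s\<^sub>1\<close>. But the
  powers of the adjoint of \<open>e\<^sub>k \<mapsto> e\<^bsub>2k+1\<^esub>\<close> tend strongly to zero, so \<open>s\<^sub>2 \<otimes> s\<^sub>1\<close> has no nonzero fixed vector.
\<close>

section \<open>Operators\<close>

lemma bop_coord_eqI:
  assumes "\<And>x y. ell2_fun (S \<cdot> ket y) x = ell2_fun (T \<cdot> ket y) x"
  shows "S = T"
  by (intro bop_ket_eqI ell2_eqI assms)

lemma ell2_fun_adj_ket: "ell2_fun (adj T \<cdot> ket y) x = cnj (ell2_fun (T \<cdot> ket x) y)"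
  by (metis cinner_adj cinner_commute cinner_ket)

lemma adj_adj [simp]: "adj (adj T) = T"
  by (rule adj_eqI) (metis cinner_adj cinner_commute)

lemma adj_mult: "adj (S * T) = adj T * adj S"
  by (rule adj_eqI) (simp add: cinner_adj)

lemma adj_add: "adj (S + T) = adj S + adj T"
  by (rule adj_eqI) (simp add: cinner_adj cinner_add_left cinner_add_right)

lemma adj_scaleC: "adj (c *\<^sub>C T) = cnj c *\<^sub>C adj T"
  by (rule adj_eqI) (simp add: cinner_adj cinner_scaleC_left cinner_scaleC_right)

lemma adj_zero [simp]: "adj 0 = 0"
  by (rule adj_eqI) simp

lemma adj_one [simp]: "adj 1 = 1"
  by (rule adj_eqI) simp

lemma norm_sq_cinner: "complex_of_real ((norm \<psi>)\<^sup>2) = cinner \<psi> \<psi>"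
  unfolding cinner_self norm_ell2_sq ..

lemma norm_sq_apply: "complex_of_real ((norm (T \<cdot> \<psi>))\<^sup>2) = cinner \<psi> ((adj T * T) \<cdot> \<psi>)"
  unfolding norm_sq_cinner by (metis adj_adj bop_apply_simps(6) cinner_adj)

text \<open>One half of the C*-identity, from Cauchy-Schwarz. It suffices for two consequences:
  \<open>adj\<close> is isometric, and \<open>adj T * T\<close> vanishes only for
  \<open>T = 0\<close>.\<close>

lemma norm_sq_le: "(norm T)\<^sup>2 \<le> norm (adj T * T)"
proof -
  have "norm T \<le> sqrt (norm (adj T * T))"
  proof (rule norm_bop_bound)
    fix \<psi>
    have "(norm (T \<cdot> \<psi>))\<^sup>2 = cmod (cinner \<psi> ((adj T * T) \<cdot> \<psi>))"
      unfolding norm_sq_apply[symmetric] by (simp only: norm_of_real) simp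
    also have "\<dots> \<le> norm \<psi> * norm ((adj T * T) \<cdot> \<psi>)" by (rule cmod_cinner_le)
    also have "\<dots> \<le> norm \<psi> * (norm (adj T * T) * norm \<psi>)"
      by (intro mult_left_mono norm_bop_apply) simp
    also have "\<dots> = (sqrt (norm (adj T * T)) * norm \<psi>)\<^sup>2"
      by (simp add: power_mult_distrib power2_eq_square)
    finally show "norm (T \<cdot> \<psi>) \<le> sqrt (norm (adj T * T)) * norm \<psi>"
      by (rule power2_le_imp_le) simp
  qed simp
  thus ?thesis by (metis norm_ge_zero power_mono real_sqrt_pow2)
qed

lemma norm_adj [simp]: "norm (adj T) = norm T"
proof -
  have "norm S \<le> norm (adj S)" for S :: "'a bop"
  proof (cases "norm S = 0")
    case False
    have "norm S * norm S \<le> norm (adj S) * norm S"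
      using norm_sq_le[of S] norm_mult_ineq[of "adj S" S] by (simp add: power2_eq_square)
    thus ?thesis using False by simp
  qed simp
  from this[of T] this[of "adj T"] show ?thesis by simp
qed

lemma adj_mult_self_eq_0_iff: "adj T * T = 0 \<longleftrightarrow> T = 0"
  using norm_sq_le[of T] by auto

lemma scaleC_bop_laws:
  fixes S T :: "'x bop"
  shows "c *\<^sub>C (S + T) = c *\<^sub>C S + c *\<^sub>C T" "c *\<^sub>C (S - T) = c *\<^sub>C S - c *\<^sub>C T"
    "(c *\<^sub>C S) * T = c *\<^sub>C (S * T)" "S * (c *\<^sub>C T) = c *\<^sub>C (S * T)"
    "(-1) *\<^sub>C T = - T" "c *\<^sub>C (0 :: 'x bop) = 0" "r *\<^sub>R T = complex_of_real r *\<^sub>C T"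
  by (auto intro!: bop_eqI ell2_eqI simp: scaleC_ell2_laws(1,2,7,9) algebra_simps)

lemma norm_scaleC_bop_le: "norm (c *\<^sub>C (T :: 'x bop)) \<le> cmod c * norm T"
  by (rule norm_bop_bound)
    (use norm_bop_apply[of T] in \<open>auto simp: norm_scaleC_ell2 mult.assoc intro!: mult_left_mono\<close>)

lemma bounded_linear_adj: "bounded_linear (adj :: 'x bop \<Rightarrow> 'x bop)"
  by (rule bounded_linear_intro[where K=1])
    (simp_all add: adj_add adj_scaleC scaleC_bop_laws(7))

lemma bounded_linear_scaleC_bop: "bounded_linear (\<lambda>T :: 'x bop. c *\<^sub>C T)"
proof (rule bounded_linear_intro[where K="cmod c"])
  show "c *\<^sub>C (r *\<^sub>R T) = r *\<^sub>R (c *\<^sub>C T)" for r and T :: "'x bop"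
    by (rule bop_eqI) (simp add: scaleC_ell2_laws(6))
qed (use norm_scaleC_bop_le[of c] in \<open>simp_all add: scaleC_bop_laws mult.commute\<close>)

section \<open>Transport along injections\<close>

lemma pull_push [simp]: "inj f \<Longrightarrow> ell2_pull f (ell2_push f \<psi>) = \<psi>"
  by (rule ell2_eqI) (simp add: ell2_fun_pull ell2_fun_push)

lemma push_zero [simp]: "inj f \<Longrightarrow> ell2_push f 0 = 0"
  by (rule ell2_eqI) (simp add: ell2_fun_push)

lemma pull_zero [simp]: "inj f \<Longrightarrow> ell2_pull f 0 = 0"
  by (rule ell2_eqI) (simp add: ell2_fun_pull)

lemma push_ket: "inj f \<Longrightarrow> ell2_push f (ket x) = ket (f x)"
  by (rule ell2_eqI) (auto simp: ell2_fun_push)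

lemma pull_ket: "inj f \<Longrightarrow> ell2_pull f (ket (f x)) = ket x"
  by (metis pull_push push_ket)

lemma pull_ket_notin: "inj f \<Longrightarrow> y \<notin> range f \<Longrightarrow> ell2_pull f (ket y) = 0"
  by (rule ell2_eqI) (auto simp: ell2_fun_pull)

lemma cinner_push:
  assumes "inj f"
  shows "cinner (ell2_push f \<psi>) \<phi> = cinner \<psi> (ell2_pull f \<phi>)"
proof -
  have "cinner (ell2_push f \<psi>) \<phi>
      = (\<Sum>\<^sub>\<infinity>y\<in>range f. cnj (ell2_fun (ell2_push f \<psi>) y) * ell2_fun \<phi> y)"
    unfolding cinner_def by (rule infsum_cong_neutral) (auto simp: ell2_fun_push assms)
  also have "\<dots> = cinner \<psi> (ell2_pull f \<phi>)"
    using assms unfolding cinner_def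
    by (subst infsum_reindex) (simp_all add: ell2_fun_push ell2_fun_pull o_def)
  finally show ?thesis .
qed

lemma cinner_pull: "inj f \<Longrightarrow> cinner (ell2_pull f \<phi>) \<psi> = cinner \<phi> (ell2_push f \<psi>)"
  by (metis cinner_commute cinner_push)

lemma extend_op_one_apply: "inj f \<Longrightarrow> extend_op f 1 \<cdot> \<psi> = ell2_push f (ell2_pull f \<psi>)"
  by (simp add: extend_op_apply)

lemma extend_op_ket: "inj f \<Longrightarrow> extend_op f T \<cdot> ket (f x) = ell2_push f (T \<cdot> ket x)"
  by (simp add: extend_op_apply pull_ket)

lemma extend_op_ket_notin: "inj f \<Longrightarrow> y \<notin> range f \<Longrightarrow> extend_op f T \<cdot> ket y = 0"
  by (simp add: extend_op_apply pull_ket_notin)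

lemma adj_extend_op: "inj f \<Longrightarrow> adj (extend_op f T) = extend_op f (adj T)"
  by (rule adj_eqI) (simp add: extend_op_apply cinner_push cinner_pull[symmetric] cinner_adj)

lemma extend_op_mult: "inj f \<Longrightarrow> extend_op f S * extend_op f T = extend_op f (S * T)"
  by (rule bop_eqI) (simp add: extend_op_apply)

lemma extend_op_zero: "inj f \<Longrightarrow> extend_op f 0 = 0"
  by (rule bop_eqI) (simp add: extend_op_apply)

lemma extend_op_mult_disjoint:
  assumes "inj f" "inj g" "range f \<inter> range g = {}"
  shows "extend_op f S * extend_op g T = 0"
proof -
  have "ell2_pull f (ell2_push g \<psi>) = 0" for \<psi>
    using assms by (intro ell2_eqI) (auto simp: ell2_fun_pull ell2_fun_push)
  thus ?thesis using assms by (intro bop_eqI) (simp add: extend_op_apply)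
qed

lemma compress_op_add: "inj f \<Longrightarrow> compress_op f (S + T) = compress_op f S + compress_op f T"
  by (rule bop_eqI) (simp add: compress_op_apply ell2_pull_linear)

lemma compress_op_scaleC: "inj f \<Longrightarrow> compress_op f (c *\<^sub>C T) = c *\<^sub>C compress_op f T"
  by (rule bop_eqI) (simp add: compress_op_apply ell2_pull_linear)

lemma compress_op_adj: "inj f \<Longrightarrow> compress_op f (adj T) = adj (compress_op f T)"
  by (rule adj_eqI[symmetric]) (simp add: compress_op_apply cinner_pull cinner_push[symmetric] cinner_adj)

lemma compress_op_one: "inj f \<Longrightarrow> compress_op f 1 = 1"
  by (rule bop_eqI) (simp add: compress_op_apply)

lemma compress_op_zero: "inj f \<Longrightarrow> compress_op f 0 = 0"
  by (rule bop_eqI) (simp add: compress_op_apply)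

lemma compress_op_sum: "inj f \<Longrightarrow> compress_op f (\<Sum>i\<in>F. T i) = (\<Sum>i\<in>F. compress_op f (T i))"
  by (induction F rule: infinite_finite_induct) (simp_all add: compress_op_add compress_op_zero)

lemma norm_compress_op: "inj f \<Longrightarrow> norm (compress_op f T) \<le> norm T"
proof (rule norm_bop_bound)
  fix \<psi> assume f: "inj f"
  have "norm (compress_op f T \<cdot> \<psi>) \<le> norm (T \<cdot> ell2_push f \<psi>)"
    using f by (simp add: compress_op_apply norm_ell2_pull)
  also have "\<dots> \<le> norm T * norm (ell2_push f \<psi>)" by (rule norm_bop_apply)
  also have "\<dots> \<le> norm T * norm \<psi>" using f by (intro mult_left_mono norm_ell2_push) auto
  finally show "norm (compress_op f T \<cdot> \<psi>) \<le> norm T * norm \<psi>" .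
qed simp

lemma bounded_linear_compress_op: "inj f \<Longrightarrow> bounded_linear (compress_op f)"
  by (rule bounded_linear_intro[where K=1])
    (simp_all add: compress_op_add compress_op_scaleC scaleC_bop_laws(7) norm_compress_op)

text \<open>\<open>extend_op f 1\<close> is the projection onto the range of the isometry given by
  \<open>f\<close>. Since it commutes with \<open>T\<close>, \<open>T\<close> maps that range into
  itself, so inserting the projection between \<open>S\<close> and \<open>T\<close> changes
  nothing.\<close>

lemma compress_op_mult:
  assumes "inj f" "extend_op f 1 * T = T * extend_op f 1"
  shows "compress_op f (S * T) = compress_op f S * compress_op f T"
proof (rule bop_eqI)
  fix \<psi>
  have "ell2_push f (ell2_pull f (T \<cdot> ell2_push f \<psi>)) = (extend_op f 1 * T) \<cdot> ell2_push f \<psi>"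
    using assms(1) by (simp add: extend_op_one_apply)
  also have "\<dots> = T \<cdot> ell2_push f \<psi>"
    unfolding assms(2) using assms(1) by (simp add: extend_op_one_apply)
  finally show "compress_op f (S * T) \<cdot> \<psi> = (compress_op f S * compress_op f T) \<cdot> \<psi>"
    using assms(1) by (simp add: compress_op_apply)
qed

lemma extend_op_bij: "bij f \<Longrightarrow> extend_op f 1 = 1"
  by (rule bop_ket_eqI) (metis bij_is_inj bij_pointE bop_apply_simps(2) extend_op_ket push_ket)

lemma compress_op_mult_bij: "bij f \<Longrightarrow> compress_op f (S * T) = compress_op f S * compress_op f T"
  by (simp add: bij_is_inj compress_op_mult extend_op_bij)

lemma compress_op_ket: "inj f \<Longrightarrow> compress_op f T \<cdot> ket x = ell2_pull f (T \<cdot> ket (f x))"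
  by (simp add: compress_op_apply push_ket)

section \<open>Block-diagonal operators\<close>

lemma block_diag_eqI:
  assumes "\<And>i. norm (a i) \<le> K" "\<And>i \<psi>. slice i (T \<cdot> \<psi>) = a i \<cdot> slice i \<psi>"
  shows "block_diag a = T"
  using ex1_block_diag[of a K] assms slice_block_diag[of a K] by blast

lemma slice_push: "slice i (ell2_push (Pair j) \<psi>) = (if i = j then \<psi> else 0)"
  by (rule ell2_eqI) (auto simp: ell2_fun_push)

lemma block_diag_push:
  assumes "\<And>i. norm (a i) \<le> K"
  shows "block_diag a \<cdot> ell2_push (Pair j) \<psi> = ell2_push (Pair j) (a j \<cdot> \<psi>)"
proof (rule ell2_eqI)
  fix p :: "'a \<times> 'b"
  have "slice i (block_diag a \<cdot> ell2_push (Pair j) \<psi>) = slice i (ell2_push (Pair j) (a j \<cdot> \<psi>))" for i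
    by (simp add: slice_block_diag[OF assms] slice_push)
  from arg_cong[OF this, of "\<lambda>\<phi>. ell2_fun \<phi> (snd p)" "fst p"]
  show "ell2_fun (block_diag a \<cdot> ell2_push (Pair j) \<psi>) p = ell2_fun (ell2_push (Pair j) (a j \<cdot> \<psi>)) p"
    by simp
qed

lemma block_diag_ket:
  "(\<And>i. norm (a i) \<le> K) \<Longrightarrow> block_diag a \<cdot> ket (i, x) = ell2_push (Pair i) (a i \<cdot> ket x)"
  by (metis block_diag_push push_ket inj_Pair)

lemma
  assumes "\<And>i. norm (a i) \<le> K"
  shows block_diag_mult_extend: "block_diag a * extend_op (Pair j) T = extend_op (Pair j) (a j * T)"
    and extend_mult_block_diag: "extend_op (Pair j) T * block_diag a = extend_op (Pair j) (T * a j)"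
  using slice_block_diag[of a K, OF assms, unfolded slice_def]
  by (auto intro!: bop_eqI simp: extend_op_apply block_diag_push[OF assms])

lemma compress_block_diag:
  assumes "\<And>i. norm (a i) \<le> K"
  shows "compress_op (Pair i) (block_diag a) = a i"
  by (rule bop_eqI)
    (simp add: compress_op_apply slice_block_diag[OF assms] slice_push flip: slice_def)

lemma block_diag_add:
  assumes "\<And>i. norm (a i) \<le> K" "\<And>i. norm (b i) \<le> M"
  shows "block_diag (\<lambda>i. a i + b i) = block_diag a + block_diag b"
  by (rule block_diag_eqI[where K="K + M"])
    (auto intro: norm_triangle_le add_mono assms
      simp: slice_linear slice_block_diag[OF assms(1)] slice_block_diag[OF assms(2)])

lemma block_diag_mult:
  assumes "\<And>i. norm (a i) \<le> K" "\<And>i. norm (b i) \<le> M"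
  shows "block_diag (\<lambda>i. a i * b i) = block_diag a * block_diag b"
proof (rule block_diag_eqI[where K="K * M"])
  have "0 \<le> K" using assms(1)[of undefined] norm_ge_zero order_trans by blast
  thus "norm (a i * b i) \<le> K * M" for i
    by (intro order_trans[OF norm_mult_ineq] mult_mono assms) auto
qed (simp add: slice_block_diag[OF assms(1)] slice_block_diag[OF assms(2)])

lemma block_diag_scaleC:
  assumes "\<And>i. norm (a i) \<le> K"
  shows "block_diag (\<lambda>i. c *\<^sub>C a i) = c *\<^sub>C block_diag a"
  by (rule block_diag_eqI[where K="cmod c * K"])
    (auto intro!: order_trans[OF norm_scaleC_bop_le] mult_left_mono assms
      simp: slice_linear slice_block_diag[OF assms])

lemma block_diag_adj:
  assumes K: "\<And>i. norm (a i) \<le> K"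
  shows "block_diag (\<lambda>i. adj (a i)) = adj (block_diag a)"
proof (rule bop_coord_eqI)
  have K': "norm (adj (a i)) \<le> K" for i using K by simp
  fix p q :: "'a \<times> 'b"
  obtain i x j y where "p = (i, x)" "q = (j, y)" by (cases p, cases q)
  thus "ell2_fun (block_diag (\<lambda>i. adj (a i)) \<cdot> ket q) p = ell2_fun (adj (block_diag a) \<cdot> ket q) p"
    by (auto simp: ell2_fun_adj_ket block_diag_ket[OF K] block_diag_ket[OF K'] ell2_fun_push
        inv_f_f[of "Pair _", OF inj_Pair])
qed

lemma norm_block_diag:
  assumes "\<And>i. norm (a i) \<le> K"
  shows "norm (block_diag a) \<le> K"
proof -
  have K0: "0 \<le> K" using assms[of undefined] norm_ge_zero order_trans by blast
  show ?thesis
  proof (rule norm_bop_bound[OF K0])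
    fix \<psi> :: "('a \<times> 'b) ell2"
    show "norm (block_diag a \<cdot> \<psi>) \<le> K * norm \<psi>"
    proof (rule norm_ell2_le)
      fix F :: "('a \<times> 'b) set" assume F: "finite F"
      let ?\<phi> = "block_diag a \<cdot> \<psi>"
      \<comment> \<open>Enlarging \<open>F\<close> to a rectangle makes the sum split into
        slices.\<close>
      have "(\<Sum>p\<in>F. (cmod (ell2_fun ?\<phi> p))\<^sup>2) \<le> (\<Sum>p\<in>fst ` F \<times> snd ` F. (cmod (ell2_fun ?\<phi> p))\<^sup>2)"
        using F by (intro sum_mono2) (force simp: image_iff)+
      also have "\<dots> = (\<Sum>i\<in>fst ` F. \<Sum>x\<in>snd ` F. (cmod (ell2_fun (slice i ?\<phi>) x))\<^sup>2)"
        by (simp add: sum.cartesian_product case_prod_beta)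
      also have "\<dots> \<le> (\<Sum>i\<in>fst ` F. (norm (slice i ?\<phi>))\<^sup>2)"
        using F by (intro sum_mono ell2_finite_sum_le) auto
      also have "\<dots> \<le> (\<Sum>i\<in>fst ` F. (K * norm (slice i \<psi>))\<^sup>2)"
        unfolding slice_block_diag[OF assms]
        by (intro sum_mono power_mono order_trans[OF norm_bop_apply] mult_right_mono assms) auto
      also have "\<dots> = K\<^sup>2 * (\<Sum>i\<in>fst ` F. (norm (slice i \<psi>))\<^sup>2)"
        by (simp add: power_mult_distrib sum_distrib_left)
      also have "\<dots> \<le> K\<^sup>2 * (norm \<psi>)\<^sup>2"
        using F by (intro mult_left_mono sum_slice_le) auto
      finally show "(\<Sum>p\<in>F. (cmod (ell2_fun ?\<phi> p))\<^sup>2) \<le> (K * norm \<psi>)\<^sup>2"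
        by (simp add: power_mult_distrib)
    qed (use K0 in simp)
  qed
qed

text \<open>Links the two descriptions of an element supported in one summand: as a member of a
  direct sum and as a transported operator.\<close>

lemma block_diag_single: "block_diag (\<lambda>i. if i = j then T else 0) = extend_op (Pair j) T"
  by (rule block_diag_eqI[where K="norm T"])
    (auto simp: extend_op_apply slice_push simp flip: slice_def)

section \<open>Tensor products\<close>

lemma ell2_fun_tensor_op:
  "ell2_fun ((S \<otimes>\<^sub>o T) \<cdot> ket (x, y)) (u, v) = ell2_fun (S \<cdot> ket x) u * ell2_fun (T \<cdot> ket y) v"
  by (simp add: ket_tensor[symmetric] tensor_op_apply)

lemma tensor_op_mult: "(S \<otimes>\<^sub>o T) * (S' \<otimes>\<^sub>o T') = (S * S') \<otimes>\<^sub>o (T * T')"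
  by (rule bop_ket_eqI, case_tac x) (simp add: ket_tensor[symmetric] tensor_op_apply)

lemma tensor_op_adj: "adj (S \<otimes>\<^sub>o T) = adj S \<otimes>\<^sub>o adj T"
  by (rule bop_coord_eqI, case_tac x, case_tac y)
    (simp add: ell2_fun_adj_ket ell2_fun_tensor_op)

lemma tensor_op_one: "1 \<otimes>\<^sub>o 1 = 1"
  by (rule bop_ket_eqI, case_tac x) (simp add: ket_tensor[symmetric] tensor_op_apply)

lemma tensor_op_scaleC: "c *\<^sub>C (S \<otimes>\<^sub>o T) = (c *\<^sub>C S) \<otimes>\<^sub>o T"
  by (rule bop_coord_eqI, case_tac x, case_tac y) (simp add: ell2_fun_tensor_op)

lemma tensor_op_zero: "0 \<otimes>\<^sub>o T = 0" "S \<otimes>\<^sub>o 0 = 0"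
  by (rule bop_coord_eqI, case_tac x, case_tac y, simp add: ell2_fun_tensor_op)+

lemma tensor_op_add:
  "(S + S') \<otimes>\<^sub>o T = S \<otimes>\<^sub>o T + S' \<otimes>\<^sub>o T" "S \<otimes>\<^sub>o (T + T') = S \<otimes>\<^sub>o T + S \<otimes>\<^sub>o T'"
  by (rule bop_coord_eqI, case_tac x, case_tac y, simp add: ell2_fun_tensor_op algebra_simps)+

lemma tensor_op_sum_left: "(\<Sum>i\<in>F. S i) \<otimes>\<^sub>o T = (\<Sum>i\<in>F. S i \<otimes>\<^sub>o T)"
  by (induction F rule: infinite_finite_induct) (simp_all add: tensor_op_zero tensor_op_add)

lemma tensor_op_sum_right: "S \<otimes>\<^sub>o (\<Sum>i\<in>F. T i) = (\<Sum>i\<in>F. S \<otimes>\<^sub>o T i)"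
  by (induction F rule: infinite_finite_induct) (simp_all add: tensor_op_zero tensor_op_add)

lemma tensor_ell2_zero [simp]: "0 \<otimes>\<^sub>v \<phi> = 0"
  by (rule ell2_eqI, case_tac x) simp

text \<open>Used to recognize the copy of an elementary tensor in one summand as an elementary
  tensor of elements of the direct sums.\<close>

lemma extend_op_tensor:
  fixes f :: "'x \<Rightarrow> 'u" and g :: "'y \<Rightarrow> 'v"
  assumes f: "inj f" and g: "inj g"
  shows "extend_op (map_prod f g) (S \<otimes>\<^sub>o T) = extend_op f S \<otimes>\<^sub>o extend_op g T"
proof (rule bop_ket_eqI)
  have inj: "inj (map_prod f g)" using f g by (rule map_prod_inj_on[of f UNIV g UNIV, simplified])
  have inv: "inv (map_prod f g) (f x, g y) = (x, y)" for x y by (rule inv_f_eq[OF inj]) simp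
  have push: "ell2_push (map_prod f g) (\<psi> \<otimes>\<^sub>v \<phi>) = ell2_push f \<psi> \<otimes>\<^sub>v ell2_push g \<phi>" for \<psi> \<phi>
  proof (rule ell2_eqI)
    fix p :: "'u \<times> 'v"
    obtain u v where p: "p = (u, v)" by (cases p)
    show "ell2_fun (ell2_push (map_prod f g) (\<psi> \<otimes>\<^sub>v \<phi>)) p = ell2_fun (ell2_push f \<psi> \<otimes>\<^sub>v ell2_push g \<phi>) p"
    proof (cases "u \<in> range f \<and> v \<in> range g")
      case True
      then obtain x y where "u = f x" "v = g y" by blast
      thus ?thesis using rangeI[of "map_prod f g" "(x, y)"]
        by (simp add: p ell2_fun_push inj f g inv)
    next
      case False
      hence "(u, v) \<notin> range (map_prod f g)" by auto
      thus ?thesis using False by (auto simp: p ell2_fun_push inj f g)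
    qed
  qed
  have pull: "ell2_pull (map_prod f g) (\<psi> \<otimes>\<^sub>v \<phi>) = ell2_pull f \<psi> \<otimes>\<^sub>v ell2_pull g \<phi>" for \<psi> \<phi>
    by (rule ell2_eqI, case_tac x) (simp add: ell2_fun_pull inj f g)
  fix p
  show "extend_op (map_prod f g) (S \<otimes>\<^sub>o T) \<cdot> ket p = (extend_op f S \<otimes>\<^sub>o extend_op g T) \<cdot> ket p"
    by (cases p) (simp add: ket_tensor[symmetric] extend_op_apply inj f g push pull tensor_op_apply)
qed

section \<open>C*-subalgebras\<close>

lemma cstar_subalgebraD:
  assumes "cstar_subalgebra A"
  shows "closed A" "0 \<in> A" "x \<in> A \<Longrightarrow> y \<in> A \<Longrightarrow> x + y \<in> A" "x \<in> A \<Longrightarrow> y \<in> A \<Longrightarrow> x * y \<in> A"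
    "x \<in> A \<Longrightarrow> c *\<^sub>C x \<in> A" "x \<in> A \<Longrightarrow> adj x \<in> A"
  using assms unfolding cstar_subalgebra_def by auto

lemma cstar_subalgebra_diff:
  assumes "cstar_subalgebra A" "x \<in> A" "y \<in> A"
  shows "x - y \<in> A"
  using cstar_subalgebraD(3)[OF assms(1,2) cstar_subalgebraD(5)[OF assms(1,3), of "-1"]]
  by (simp add: scaleC_bop_laws)

lemma cstar_subalgebra_generated: "cstar_subalgebra (cstar_generated X)"
  unfolding cstar_generated_def cstar_subalgebra_def by (auto intro!: closed_Inter)

lemma subset_cstar_generated: "X \<subseteq> cstar_generated X"
  unfolding cstar_generated_def by blast

lemma cstar_generated_subset: "cstar_subalgebra A \<Longrightarrow> X \<subseteq> A \<Longrightarrow> cstar_generated X \<subseteq> A"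
  unfolding cstar_generated_def by blast

lemma closed_vimage_Collect: "closed A \<Longrightarrow> continuous_on UNIV f \<Longrightarrow> closed {x. f x \<in> A}"
  using closed_vimage[of A f] by (simp add: vimage_def)

text \<open>Multiplication is continuous, so commuting with \<open>P\<close> is a closed condition;
  as each \<open>P\<close> is self-adjoint, taking adjoints in \<open>P * T = T * P\<close> gives
  the same relation for \<open>adj T\<close>.\<close>

lemma cstar_subalgebra_commutant:
  assumes "\<And>P. P \<in> \<P> \<Longrightarrow> adj P = P"
  shows "cstar_subalgebra {T. \<forall>P\<in>\<P>. P * T = T * P}"
  unfolding cstar_subalgebra_def
proof (intro conjI ballI allI)
  have "closed {T. P * T = T * P}" for P :: "'a bop"
    by (rule closed_Collect_eq) (auto intro!: continuous_intros)
  thus "closed {T. \<forall>P\<in>\<P>. P * T = T * P}"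
    by (simp add: Collect_ball_eq closed_INT)
next
  fix x y assume "x \<in> {T. \<forall>P\<in>\<P>. P * T = T * P}" "y \<in> {T. \<forall>P\<in>\<P>. P * T = T * P}"
  thus "x * y \<in> {T. \<forall>P\<in>\<P>. P * T = T * P}" by auto (metis mult.assoc)
next
  fix x assume x: "x \<in> {T. \<forall>P\<in>\<P>. P * T = T * P}"
  thus "adj x \<in> {T. \<forall>P\<in>\<P>. P * T = T * P}" by auto (metis adj_mult assms)
qed (auto simp: algebra_simps scaleC_bop_laws)

text \<open>Serves as induction over \<open>cstar_generated\<close>: once the generators lie in this
  set, the whole generated algebra does. The domain \<open>D\<close> is there because the maps of
  interest are multiplicative only on part of the operators.\<close>

lemma cstar_subalgebra_preimage:
  assumes D: "cstar_subalgebra D" and B: "cstar_subalgebra B"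
    and f: "star_hom D UNIV f" "bounded_linear f"
  shows "cstar_subalgebra {x \<in> D. f x \<in> B}"
proof -
  have "closed {x. f x \<in> B}"
    by (rule closed_vimage_Collect)
      (use cstar_subalgebraD(1)[OF B] f(2) in \<open>auto intro: linear_continuous_on\<close>)
  moreover have "{x \<in> D. f x \<in> B} = D \<inter> {x. f x \<in> B}" by blast
  ultimately have "closed {x \<in> D. f x \<in> B}" using cstar_subalgebraD(1)[OF D] by auto
  moreover have "f 0 = 0" using f(2) by (rule linear_simps)
  ultimately show ?thesis
    using f(1) unfolding cstar_subalgebra_def star_hom_def
    by (auto intro: cstar_subalgebraD[OF D] cstar_subalgebraD[OF B])
qed

subsection \<open>The minimal tensor product\<close>

lemma min_tensor_tensor:
  assumes "x \<in> A" "y \<in> B"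
  shows "x \<otimes>\<^sub>o y \<in> min_tensor A B"
  unfolding min_tensor_def
  by (rule subsetD[OF closure_subset])
    (use assms in \<open>auto intro!: exI[of _ 1] exI[of _ "\<lambda>_. x"] exI[of _ "\<lambda>_. y"]\<close>)

lemma min_tensor_induct [consumes 1, case_names tensor zero add closed]:
  assumes "x \<in> min_tensor A B"
    and tensor: "\<And>a b. a \<in> A \<Longrightarrow> b \<in> B \<Longrightarrow> P (a \<otimes>\<^sub>o b)"
    and "P 0" and add: "\<And>x y. P x \<Longrightarrow> P y \<Longrightarrow> P (x + y)" and "closed {x. P x}"
  shows "P x"
proof -
  have "P (\<Sum>k<N. a k \<otimes>\<^sub>o b k)" if "\<forall>k<N. a k \<in> A \<and> b k \<in> B" for N :: nat and a b
    using that by (induction N) (auto intro: assms)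
  hence "min_tensor A B \<subseteq> {x. P x}"
    unfolding min_tensor_def by (intro closure_minimal) (use assms(5) in auto)
  thus ?thesis using assms(1) by blast
qed

lemma closed_min_tensor: "closed (min_tensor A B)"
  unfolding min_tensor_def by simp

lemma zero_min_tensor: "0 \<in> min_tensor A B"
  unfolding min_tensor_def by (rule subsetD[OF closure_subset]) (auto intro: exI[of _ 0])

text \<open>Adding an elementary tensor to a finite sum only lengthens the sum. Continuity extends
  this to limits on the left, iteration to finite sums on the right, and continuity again to limits
  on the right.\<close>

lemma min_tensor_add:
  assumes "x \<in> min_tensor A B" "y \<in> min_tensor A B"
  shows "x + y \<in> min_tensor A B"
proof -
  define T where "T = {\<Sum>k<N. a k \<otimes>\<^sub>o b k | (N :: nat) a b. \<forall>k<N. a k \<in> A \<and> b k \<in> B}"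
  have one: "t + u \<otimes>\<^sub>o v \<in> T" if "t \<in> T" "u \<in> A" "v \<in> B" for t u v
  proof -
    obtain N :: nat and a b where t: "t = (\<Sum>k<N. a k \<otimes>\<^sub>o b k)" and ab: "\<forall>k<N. a k \<in> A \<and> b k \<in> B"
      using \<open>t \<in> T\<close> unfolding T_def by blast
    have "t + u \<otimes>\<^sub>o v = (\<Sum>k<Suc N. (a(N := u)) k \<otimes>\<^sub>o (b(N := v)) k)" by (simp add: t)
    moreover have "\<forall>k<Suc N. (a(N := u)) k \<in> A \<and> (b(N := v)) k \<in> B" using ab that by auto
    ultimately show ?thesis unfolding T_def by blast
  qed
  have cl: "x + u \<otimes>\<^sub>o v \<in> closure T" if "x \<in> closure T" "u \<in> A" "v \<in> B" for x u v
  proof -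
    have "(\<lambda>x. x + u \<otimes>\<^sub>o v) ` closure T \<subseteq> closure T"
      by (rule image_closure_subset)
        (use one[OF _ that(2,3)] closure_subset in \<open>auto intro!: continuous_intros\<close>)
    thus ?thesis using that by blast
  qed
  have "x + (\<Sum>k<N. a k \<otimes>\<^sub>o b k) \<in> closure T"
    if "x \<in> closure T" "\<forall>k<N. a k \<in> A \<and> b k \<in> B" for x a b and N :: nat
    using that(2) by (induction N) (use that(1) cl in \<open>auto simp: add.assoc[symmetric]\<close>)
  hence "x + t \<in> closure T" if "x \<in> closure T" "t \<in> T" for x t
    using that unfolding T_def by blast
  hence "(\<lambda>t. x + t) ` closure T \<subseteq> closure T" if "x \<in> closure T" for x
    by (intro image_closure_subset) (use that in \<open>auto intro!: continuous_intros\<close>)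
  thus ?thesis using assms unfolding min_tensor_def T_def[symmetric] by blast
qed

lemma min_tensor_map:
  assumes "x \<in> min_tensor A B" "bounded_linear f"
    and "\<And>a b. a \<in> A \<Longrightarrow> b \<in> B \<Longrightarrow> f (a \<otimes>\<^sub>o b) \<in> min_tensor C D"
  shows "f x \<in> min_tensor C D"
  using assms(1)
proof (induction x rule: min_tensor_induct)
  case closed
  show ?case
    by (intro closed_vimage_Collect closed_min_tensor linear_continuous_on assms)
qed (use assms(2,3) in \<open>auto simp: linear_simps zero_min_tensor min_tensor_add\<close>)

text \<open>What the factors provide so that \<open>min_tensor\<close> is a C*-algebra; sums and
  limits are supplied by the tensor product itself. This spares a proof that the direct sum
  \<open>cuntz_sum\<close> is complete.\<close>

definition star_closed :: "'x bop set \<Rightarrow> bool" where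
  "star_closed A \<longleftrightarrow> (\<forall>x\<in>A. \<forall>y\<in>A. x * y \<in> A) \<and> (\<forall>c. \<forall>x\<in>A. c *\<^sub>C x \<in> A) \<and> (\<forall>x\<in>A. adj x \<in> A)"

lemma star_closed_subalgebra: "cstar_subalgebra A \<Longrightarrow> star_closed A"
  unfolding cstar_subalgebra_def star_closed_def by auto

lemma cstar_subalgebra_min_tensor:
  assumes "star_closed A" "star_closed B"
  shows "cstar_subalgebra (min_tensor A B)"
  unfolding cstar_subalgebra_def
proof (intro conjI ballI allI)
  fix x y assume x: "x \<in> min_tensor A B" and y: "y \<in> min_tensor A B"
  have *: "x * (c \<otimes>\<^sub>o d) \<in> min_tensor A B" if "c \<in> A" "d \<in> B" for c d
    by (rule min_tensor_map[OF x bounded_linear_mult_left])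
      (use assms that in \<open>auto simp: tensor_op_mult star_closed_def intro!: min_tensor_tensor\<close>)
  show "x * y \<in> min_tensor A B"
    by (rule min_tensor_map[OF y bounded_linear_mult_right *])
next
  fix x assume x: "x \<in> min_tensor A B"
  show "adj x \<in> min_tensor A B"
    by (rule min_tensor_map[OF x bounded_linear_adj])
      (use assms in \<open>auto simp: tensor_op_adj star_closed_def intro!: min_tensor_tensor\<close>)
  show "c *\<^sub>C x \<in> min_tensor A B" for c
    by (rule min_tensor_map[OF x bounded_linear_scaleC_bop])
      (use assms in \<open>auto simp: tensor_op_scaleC star_closed_def intro!: min_tensor_tensor\<close>)
qed (auto intro: closed_min_tensor zero_min_tensor min_tensor_add)

lemma bounded_linear_flip_op: "bounded_linear flip_op"
  unfolding flip_op_def by (rule bounded_linear_compress_op) simp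

lemma flip_op_min_tensor: "x \<in> min_tensor A A \<Longrightarrow> flip_op x \<in> min_tensor A A"
  by (erule min_tensor_map[OF _ bounded_linear_flip_op]) (simp add: flip_op_tensor min_tensor_tensor)

text \<open>The relation holds on elementary tensors and is additive and closed. It is applied to
  projections onto blocks, to see that elements of the tensor product preserve a pair of
  representations.\<close>

lemma min_tensor_commute:
  assumes "x \<in> min_tensor A B" "\<And>a. a \<in> A \<Longrightarrow> P * a = a * P" "\<And>b. b \<in> B \<Longrightarrow> Q * b = b * Q"
  shows "(P \<otimes>\<^sub>o Q) * x = x * (P \<otimes>\<^sub>o Q)"
  using assms(1)
proof (induction x rule: min_tensor_induct)
  case closed
  show ?case by (rule closed_Collect_eq) (auto intro!: continuous_intros)
qed (simp_all add: tensor_op_mult assms(2,3) algebra_simps)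

lemma star_closed_c0_sum:
  assumes A: "\<And>n. n \<in> N \<Longrightarrow> star_closed (A n)"
  shows "star_closed (c0_sum N A)"
proof -
  \<comment> \<open>A null sequence is bounded, and a uniform bound is what makes the block-diagonal
    operator exist.\<close>
  have bdd: "\<exists>K. \<forall>n. norm (a n) \<le> K"
    if "(\<lambda>n. norm (a n)) \<longlonglongrightarrow> 0" for a :: "nat \<Rightarrow> 'a bop"
    using convergent_imp_Bseq[OF convergentI[OF that]] by (auto simp: Bseq_def)
  have mem: "block_diag a \<in> c0_sum N A"
    if "\<forall>n\<in>N. a n \<in> A n" "\<forall>n. n \<notin> N \<longrightarrow> a n = 0" "(\<lambda>n. norm (a n)) \<longlonglongrightarrow> 0" for a
    using that unfolding c0_sum_def by blast
  show ?thesis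
    unfolding star_closed_def
  proof (intro conjI ballI allI)
    fix x y assume "x \<in> c0_sum N A" "y \<in> c0_sum N A"
    then obtain a b where x: "x = block_diag a" "\<forall>n\<in>N. a n \<in> A n" "\<forall>n. n \<notin> N \<longrightarrow> a n = 0"
        "(\<lambda>n. norm (a n)) \<longlonglongrightarrow> 0"
      and y: "y = block_diag b" "\<forall>n\<in>N. b n \<in> A n" "\<forall>n. n \<notin> N \<longrightarrow> b n = 0"
        "(\<lambda>n. norm (b n)) \<longlonglongrightarrow> 0"
      unfolding c0_sum_def by blast
    from bdd[OF x(4)] bdd[OF y(4)] obtain K M where "\<And>n. norm (a n) \<le> K" "\<And>n. norm (b n) \<le> M"
      by blast
    hence "x * y = block_diag (\<lambda>n. a n * b n)" unfolding x(1) y(1) by (rule block_diag_mult[symmetric])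
    moreover have "(\<lambda>n. norm (a n * b n)) \<longlonglongrightarrow> 0"
    proof (rule Lim_null_comparison)
      show "(\<lambda>n. norm (a n) * norm (b n)) \<longlonglongrightarrow> 0" using tendsto_mult[OF x(4) y(4)] by simp
    qed (simp add: norm_mult_ineq)
    ultimately show "x * y \<in> c0_sum N A"
      using x(2,3) y(2,3) A by (auto intro!: mem simp: star_closed_def)
  next
    fix x assume "x \<in> c0_sum N A"
    then obtain a where x: "x = block_diag a" "\<forall>n\<in>N. a n \<in> A n" "\<forall>n. n \<notin> N \<longrightarrow> a n = 0"
        "(\<lambda>n. norm (a n)) \<longlonglongrightarrow> 0"
      unfolding c0_sum_def by blast
    from bdd[OF x(4)] obtain K where K: "\<And>n. norm (a n) \<le> K" by blast
    have "adj x = block_diag (\<lambda>n. adj (a n))" unfolding x(1) by (rule block_diag_adj[OF K, symmetric])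
    thus "adj x \<in> c0_sum N A" using x(2-4) A by (auto intro!: mem simp: star_closed_def)
    fix c
    have "c *\<^sub>C x = block_diag (\<lambda>n. c *\<^sub>C a n)" unfolding x(1) by (rule block_diag_scaleC[OF K, symmetric])
    moreover have "(\<lambda>n. norm (c *\<^sub>C a n)) \<longlonglongrightarrow> 0"
    proof (rule Lim_null_comparison)
      show "(\<lambda>n. cmod c * norm (a n)) \<longlonglongrightarrow> 0" using tendsto_mult_left[OF x(4)] by simp
    qed (simp add: norm_scaleC_bop_le)
    ultimately show "c *\<^sub>C x \<in> c0_sum N A"
      using x(2,3) A by (auto intro!: mem simp: star_closed_def scaleC_bop_laws)
  qed
qed

section \<open>The embeddings of Cuntz algebras\<close>

lemma norm_isometry: "adj S * S = 1 \<Longrightarrow> norm S \<le> 1"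
  using norm_sq_le[of S] power2_le_imp_le[of "norm S" 1] by simp

lemma cuntz_family_norm_le: "cuntz_family n S \<Longrightarrow> i \<in> {1..n} \<Longrightarrow> norm (S i) \<le> 1"
  unfolding cuntz_family_def by (auto intro: norm_isometry)

lemma cuntz_gen_block_norm: "i \<in> {1..n} \<Longrightarrow> norm (if cuntz_family n S then S i else 0) \<le> 1"
  by (auto intro: cuntz_family_norm_le)

lemma cuntz_unit_block_norm: "norm (if cuntz_family n S then 1 else 0 :: nat bop) \<le> 1"
  by auto

lemma cstar_subalgebra_cuntz: "cstar_subalgebra (cuntz_algebra n)"
  unfolding cuntz_algebra_def by (rule cstar_subalgebra_generated)

lemma cuntz_unit_in: "cuntz_unit n \<in> cuntz_algebra n"
  and cuntz_gen_in: "i \<in> {1..n} \<Longrightarrow> cuntz_gen n i \<in> cuntz_algebra n"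
  using subset_cstar_generated[of "insert (cuntz_unit n) (cuntz_gen n ` {1..n})"]
  by (simp_all add: cuntz_algebra_def image_subset_iff)

text \<open>The commutant of the block projections, that is, the operators acting on each block
  separately. Reading off a block is multiplicative on this algebra, which contains all Cuntz
  algebras.\<close>

definition block_preserving :: "('i \<times> 'x) bop set" where
  "block_preserving = {T. \<forall>P\<in>range (\<lambda>i. extend_op (Pair i) 1). P * T = T * P}"

lemma cstar_subalgebra_block_preserving: "cstar_subalgebra block_preserving"
  unfolding block_preserving_def by (rule cstar_subalgebra_commutant) (auto simp: adj_extend_op)

lemma block_diag_preserving:
  assumes "\<And>i. norm (a i) \<le> K"
  shows "block_diag a \<in> block_preserving"
  unfolding block_preserving_def
  by (simp add: block_diag_mult_extend[OF assms] extend_mult_block_diag[OF assms])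

lemma compress_block_preserving:
  "T \<in> block_preserving \<Longrightarrow> compress_op (Pair i) (S * T) = compress_op (Pair i) S * compress_op (Pair i) T"
  unfolding block_preserving_def by (intro compress_op_mult) auto

lemma cuntz_algebra_preserving: "cuntz_algebra n \<subseteq> block_preserving"
  unfolding cuntz_algebra_def
  by (intro cstar_generated_subset cstar_subalgebra_block_preserving)
    (auto simp: cuntz_unit_def cuntz_gen_def
      intro!: block_diag_preserving[where K=1] cuntz_unit_block_norm cuntz_gen_block_norm)

text \<open>The family \<open>S i \<otimes> S' j\<close>, moved from \<open>\<ell>\<^sup>2(\<nat> \<times> \<nat>)\<close> to \<open>\<ell>\<^sup>2(\<nat>)\<close>, is itself one of the families indexing
  the blocks of \<open>\<O>\<^bsub>nm\<^esub>\<close>. So \<open>\<phi>\<^bsub>n,m\<^esub>\<close> is obtained by reading off, in the block \<open>(S, S')\<close>, the block of the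
  argument at that family. The value \<open>0\<close> is not a Cuntz family, so the blocks outside the support of the
  units also match.\<close>

definition tensor_family :: "nat \<Rightarrow> nat \<Rightarrow> (nat \<Rightarrow> nat bop) \<Rightarrow> (nat \<Rightarrow> nat bop) \<Rightarrow> nat \<Rightarrow> nat bop" where
  "tensor_family n m S S' k =
     (if cuntz_family n S \<and> cuntz_family m S'
      then compress_op prod_decode (S ((k - 1) div m + 1) \<otimes>\<^sub>o S' ((k - 1) mod m + 1)) else 0)"

section \<open>Numbering the pairs of generators, and tensor products of Cuntz families\<close>

lemma tensor_index:
  fixes i j n m :: nat
  assumes "i \<in> {1..n}" "j \<in> {1..m}"
  shows "(m * (i - 1) + j - 1) div m + 1 = i" "(m * (i - 1) + j - 1) mod m + 1 = j"
    "m * (i - 1) + j \<in> {1..n * m}"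
proof -
  \<comment> \<open>Counted from 0, the numbering is division with remainder:
    \<open>k - 1 = m * i' + j'\<close> with \<open>j' < m\<close>.\<close>
  obtain i' j' where ij: "i = Suc i'" "j = Suc j'" using assms by (cases i; cases j) auto
  show "(m * (i - 1) + j - 1) div m + 1 = i" "(m * (i - 1) + j - 1) mod m + 1 = j"
    using assms(2) by (auto simp: ij)
  have "m * i' + Suc j' \<le> m * i' + m" using assms(2) by (auto simp: ij)
  also have "\<dots> \<le> n * m" using assms(1) mult_le_mono2[of "Suc i'" n m] by (auto simp: ij mult.commute)
  finally show "m * (i - 1) + j \<in> {1..n * m}" by (simp add: ij)
qed

lemma bij_betw_tensor_index:
  fixes n m :: nat
  shows
  "bij_betw (\<lambda>(i, j). m * (i - 1) + j) ({1..n} \<times> {1..m}) {1..n * m}"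
proof (rule bij_betw_byWitness[where f' = "\<lambda>k. ((k - 1) div m + 1, (k - 1) mod m + 1)"])
  show "(\<lambda>k. ((k - 1) div m + 1, (k - 1) mod m + 1)) ` {1..n * m} \<subseteq> {1..n} \<times> {1..m}"
  proof (rule image_subsetI)
    fix k assume k: "k \<in> {1..n * m}"
    hence m: "m > 0" by (cases m) auto
    have "k - 1 < n * m" using k by auto
    hence "(k - 1) div m < n" using m by (simp add: div_less_iff_less_mult)
    thus "((k - 1) div m + 1, (k - 1) mod m + 1) \<in> {1..n} \<times> {1..m}"
      using m mod_less_divisor[OF m, of "k - 1"] by auto
  qed
  show "(\<lambda>(i, j). m * (i - 1) + j) ` ({1..n} \<times> {1..m}) \<subseteq> {1..n * m}"
    using tensor_index(3) by auto
  show "\<forall>p\<in>{1..n} \<times> {1..m}.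
      (((case p of (i, j) \<Rightarrow> m * (i - 1) + j) - 1) div m + 1,
       ((case p of (i, j) \<Rightarrow> m * (i - 1) + j) - 1) mod m + 1) = p"
    using tensor_index(1,2) by auto
  show "\<forall>k\<in>{1..n * m}. (case ((k - 1) div m + 1, (k - 1) mod m + 1) of (i, j) \<Rightarrow> m * (i - 1) + j) = k"
    by auto
qed

lemma tensor_indexE:
  fixes n m :: nat
  assumes "k \<in> {1..n * m}"
  obtains i j where "i \<in> {1..n}" "j \<in> {1..m}" "k = m * (i - 1) + j"
proof -
  have "k \<in> (\<lambda>(i, j). m * (i - 1) + j) ` ({1..n} \<times> {1..m})"
    using assms bij_betw_imp_surj_on[OF bij_betw_tensor_index[of m n]] by simp
  thus ?thesis by (rule imageE) (auto intro: that)
qed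

lemma tensor_family_index:
  assumes "cuntz_family n S" "cuntz_family m S'" "i \<in> {1..n}" "j \<in> {1..m}"
  shows "tensor_family n m S S' (m * (i - 1) + j) = compress_op prod_decode (S i \<otimes>\<^sub>o S' j)"
  unfolding tensor_family_def using assms by (simp only: tensor_index if_True simp_thms)

text \<open>Because \<open>prod_decode\<close> is a bijection, compression along it is a unital
  *-homomorphism, so each relation follows from the relations of the two factors. The clause for
  \<open>n * m = 1\<close> arises only from \<open>n = m = 1\<close>.\<close>

lemma cuntz_family_tensor_family:
  assumes S: "cuntz_family n S" and S': "cuntz_family m S'"
  shows "cuntz_family (n * m) (tensor_family n m S S')"
proof -
  let ?C = "compress_op prod_decode :: (nat \<times> nat) bop \<Rightarrow> nat bop"
  let ?W = "tensor_family n m S S'"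
  note hom = compress_op_adj[OF inj_prod_decode, symmetric]
    compress_op_mult_bij[OF bij_prod_decode, symmetric]
  have "adj (?W k) * ?W l = (if k = l then 1 else 0)" if kl: "k \<in> {1..n * m}" "l \<in> {1..n * m}" for k l
  proof -
    obtain i j where k: "i \<in> {1..n}" "j \<in> {1..m}" "k = m * (i - 1) + j" by (rule tensor_indexE[OF kl(1)])
    obtain i' j' where l: "i' \<in> {1..n}" "j' \<in> {1..m}" "l = m * (i' - 1) + j'" by (rule tensor_indexE[OF kl(2)])
    have "k = l \<longleftrightarrow> i = i' \<and> j = j'"
      using k l by (metis tensor_index(1,2))
    moreover have "adj (?W k) * ?W l = ?C ((adj (S i) * S i') \<otimes>\<^sub>o (adj (S' j) * S' j'))"
      unfolding k(3) l(3) tensor_family_index[OF S S' k(1,2)] tensor_family_index[OF S S' l(1,2)] hom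
        tensor_op_adj tensor_op_mult ..
    moreover have "adj (S i) * S i' = (if i = i' then 1 else 0)" "adj (S' j) * S' j' = (if j = j' then 1 else 0)"
      using S S' k l unfolding cuntz_family_def by blast+
    ultimately show ?thesis
      by (simp add: tensor_op_one tensor_op_zero compress_op_one compress_op_zero inj_prod_decode)
  qed
  moreover have "(\<Sum>k=1..n * m. ?W k * adj (?W k)) = 1"
  proof -
    have "(\<Sum>k=1..n * m. ?W k * adj (?W k))
        = (\<Sum>(i, j)\<in>{1..n} \<times> {1..m}. ?W (m * (i - 1) + j) * adj (?W (m * (i - 1) + j)))"
      using sum.reindex_bij_betw[OF bij_betw_tensor_index[of m n], of "\<lambda>k. ?W k * adj (?W k)"]
      by (simp add: case_prod_beta)
    also have "\<dots> = (\<Sum>(i, j)\<in>{1..n} \<times> {1..m}. ?C ((S i * adj (S i)) \<otimes>\<^sub>o (S' j * adj (S' j))))"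
      by (intro sum.cong refl) (auto simp only: split_paired_all mem_Times_iff fst_conv snd_conv
          case_prod_conv tensor_family_index[OF S S'] hom tensor_op_adj tensor_op_mult)
    also have "\<dots> = ?C ((\<Sum>i=1..n. S i * adj (S i)) \<otimes>\<^sub>o (\<Sum>j=1..m. S' j * adj (S' j)))"
      by (simp add: sum.cartesian_product[symmetric] tensor_op_sum_left tensor_op_sum_right
          compress_op_sum inj_prod_decode, rule sum.swap)
    also have "\<dots> = 1"
      using S S' by (simp add: cuntz_family_def tensor_op_one compress_op_one inj_prod_decode)
    finally show ?thesis .
  qed
  moreover have "?W 1 = 1" if "n * m = 1"
  proof -
    have "n = 1" "m = 1" using that by auto
    thus ?thesis
      using tensor_family_index[OF S S', of 1 1] S S'
      by (simp add: cuntz_family_def tensor_op_one compress_op_one inj_prod_decode)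
  qed
  ultimately show ?thesis unfolding cuntz_family_def by blast
qed

lemma cuntz_family_tensor_family_iff:
  "cuntz_family (n * m) (tensor_family n m S S') \<longleftrightarrow> cuntz_family n S \<and> cuntz_family m S'"
proof
  assume W: "cuntz_family (n * m) (tensor_family n m S S')"
  show "cuntz_family n S \<and> cuntz_family m S'"
  proof (rule ccontr)
    assume "\<not> (cuntz_family n S \<and> cuntz_family m S')"
    hence "tensor_family n m S S' = (\<lambda>_. 0)" by (auto simp: tensor_family_def)
    with W show False by (simp add: cuntz_family_def)
  qed
qed (simp add: cuntz_family_tensor_family)

text \<open>Regroups a basis label of the tensor product: first the two representations, then the
  two positions inside them. The positions are coded as one number to match the
  \<open>prod_decode\<close> in \<open>tensor_family\<close>, whose members act on the space over
  the natural numbers.\<close>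

definition reindex_pair :: "cuntz_index \<times> cuntz_index \<Rightarrow> ((nat \<Rightarrow> nat bop) \<times> (nat \<Rightarrow> nat bop)) \<times> nat" where
  "reindex_pair = (\<lambda>((S, a), (S', b)). ((S, S'), prod_encode (a, b)))"

lemma reindex_pair_simp [simp]: "reindex_pair ((S, a), (S', b)) = ((S, S'), prod_encode (a, b))"
  by (simp add: reindex_pair_def)

lemma bij_reindex_pair: "bij reindex_pair"
proof (rule bijI)
  show "inj reindex_pair" by (auto simp: inj_def reindex_pair_def)
  have "p = reindex_pair ((fst (fst p), fst (prod_decode (snd p))), (snd (fst p), snd (prod_decode (snd p))))"
    for p by (simp add: reindex_pair_def)
  thus "surj reindex_pair" by (rule surjI[OF sym])
qed

definition phi_hom :: "nat \<Rightarrow> nat \<Rightarrow> cuntz_index bop \<Rightarrow> (cuntz_index \<times> cuntz_index) bop" where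
  "phi_hom n m x =
     compress_op reindex_pair (block_diag (\<lambda>p. compress_op (Pair (tensor_family n m (fst p) (snd p))) x))"

text \<open>Compression to a block respects the linear and adjoint structure everywhere and products
  of block-preserving operators. Each block has norm at most \<open>norm x\<close>, so the blocks
  assemble to a bounded operator, and reindexing along a bijection is a *-isomorphism.\<close>

lemma star_hom_phi: "star_hom block_preserving UNIV (phi_hom n m)"
  and bounded_linear_phi: "bounded_linear (phi_hom n m)"
proof -
  note inj = bij_is_inj[OF bij_reindex_pair]
  define c where "c x = (\<lambda>p. compress_op (Pair (tensor_family n m (fst p) (snd p))) x)"
    for x :: "cuntz_index bop"
  have phi: "phi_hom n m x = compress_op reindex_pair (block_diag (c x))" for x
    by (simp add: phi_hom_def c_def)
  have N: "norm (c x p) \<le> norm x" for x p by (simp add: c_def norm_compress_op)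
  have add: "phi_hom n m (x + y) = phi_hom n m x + phi_hom n m y" for x y
  proof -
    have "c (x + y) = (\<lambda>p. c x p + c y p)" by (simp add: c_def compress_op_add)
    thus ?thesis
      using block_diag_add[of "c x" "norm x" "c y" "norm y"] by (simp add: phi N compress_op_add inj)
  qed
  have scale: "phi_hom n m (k *\<^sub>C x) = k *\<^sub>C phi_hom n m x" for k x
  proof -
    have "c (k *\<^sub>C x) = (\<lambda>p. k *\<^sub>C c x p)" by (simp add: c_def compress_op_scaleC)
    thus ?thesis
      using block_diag_scaleC[of "c x" "norm x"] by (simp add: phi N compress_op_scaleC inj)
  qed
  have adj: "phi_hom n m (adj x) = adj (phi_hom n m x)" for x
  proof -
    have "c (adj x) = (\<lambda>p. adj (c x p))" by (simp add: c_def compress_op_adj)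
    thus ?thesis
      using block_diag_adj[of "c x" "norm x"] by (simp add: phi N compress_op_adj inj)
  qed
  have mult: "phi_hom n m (x * y) = phi_hom n m x * phi_hom n m y" if "y \<in> block_preserving" for x y
  proof -
    have "c (x * y) = (\<lambda>p. c x p * c y p)" by (simp add: c_def compress_block_preserving[OF that])
    thus ?thesis
      using block_diag_mult[of "c x" "norm x" "c y" "norm y"]
      by (simp add: phi N compress_op_mult_bij bij_reindex_pair)
  qed
  show "star_hom block_preserving UNIV (phi_hom n m)"
    unfolding star_hom_def using add scale adj mult by auto
  have "norm (phi_hom n m x) \<le> norm x" for x
    unfolding phi
    by (rule order_trans[OF norm_compress_op[OF inj] norm_block_diag[OF N]])
  thus "bounded_linear (phi_hom n m)"
    by (intro bounded_linear_intro[where K=1]) (simp_all add: add scale scaleC_bop_laws(7))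
qed

text \<open>The common part of the computations for the unit and for the generators: only the blocks
  of the argument at tensor families enter, and the two sides are compared entry by entry.\<close>

lemma phi_hom_block_diag:
  assumes K: "\<And>S. norm (c S) \<le> K" and K1: "\<And>S. norm (a S) \<le> K1" and K2: "\<And>S. norm (b S) \<le> K2"
    and c: "\<And>S S'. c (tensor_family n m S S') = compress_op prod_decode (a S \<otimes>\<^sub>o b S')"
  shows "phi_hom n m (block_diag c) = block_diag a \<otimes>\<^sub>o block_diag b"
proof (rule bop_coord_eqI)
  fix p q :: "cuntz_index \<times> cuntz_index"
  obtain T u T' v S x S' y where p: "p = ((T, u), (T', v))" and q: "q = ((S, x), (S', y))"
    by (metis prod.exhaust)
  have K': "norm (compress_op prod_decode (a (fst p) \<otimes>\<^sub>o b (snd p))) \<le> K" for p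
    unfolding c[symmetric] by (rule K)
  show "ell2_fun (phi_hom n m (block_diag c) \<cdot> ket q) p = ell2_fun ((block_diag a \<otimes>\<^sub>o block_diag b) \<cdot> ket q) p"
    by (auto simp: phi_hom_def p q compress_block_diag[OF K] compress_op_ket bij_is_inj[OF bij_reindex_pair]
        ell2_fun_pull block_diag_ket[OF K'] block_diag_ket[OF K1] block_diag_ket[OF K2]
        ell2_fun_tensor_op ell2_fun_push inv_f_f[of "Pair _", OF inj_Pair] c inj_prod_decode)
qed

lemma phi_hom_unit: "phi_hom n m (cuntz_unit (n * m)) = cuntz_unit n \<otimes>\<^sub>o cuntz_unit m"
  unfolding cuntz_unit_def
  by (rule phi_hom_block_diag[OF cuntz_unit_block_norm cuntz_unit_block_norm cuntz_unit_block_norm])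
    (auto simp: cuntz_family_tensor_family_iff tensor_op_one tensor_op_zero compress_op_one
      compress_op_zero inj_prod_decode)

lemma phi_hom_gen:
  assumes "i \<in> {1..n}" "j \<in> {1..m}"
  shows "phi_hom n m (cuntz_gen (n * m) (m * (i - 1) + j)) = cuntz_gen n i \<otimes>\<^sub>o cuntz_gen m j"
  unfolding cuntz_gen_def
  by (rule phi_hom_block_diag[OF cuntz_gen_block_norm[OF tensor_index(3)[OF assms]]
        cuntz_gen_block_norm[OF assms(1)] cuntz_gen_block_norm[OF assms(2)]])
    (use assms in \<open>auto simp only: cuntz_family_tensor_family_iff tensor_op_zero if_True if_False
      compress_op_zero inj_prod_decode tensor_family_index simp_thms split: if_splits\<close>)

text \<open>The block-preserving operators with image in the tensor product form a C*-subalgebra; it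
  contains the unit and the generators, hence all of the Cuntz algebra.\<close>

lemma phi_hom_range: "x \<in> cuntz_algebra (n * m) \<Longrightarrow> phi_hom n m x \<in> min_tensor (cuntz_algebra n) (cuntz_algebra m)"
proof -
  let ?M = "min_tensor (cuntz_algebra n) (cuntz_algebra m)"
  have "cuntz_algebra (n * m) \<subseteq> {x \<in> block_preserving. phi_hom n m x \<in> ?M}"
    unfolding cuntz_algebra_def[of "n * m"]
  proof (rule cstar_generated_subset)
    show "cstar_subalgebra {x \<in> block_preserving. phi_hom n m x \<in> ?M}"
      by (rule cstar_subalgebra_preimage[OF cstar_subalgebra_block_preserving
            cstar_subalgebra_min_tensor star_hom_phi bounded_linear_phi])
        (simp_all add: star_closed_subalgebra cstar_subalgebra_cuntz)
    have "phi_hom n m (cuntz_gen (n * m) k) \<in> ?M" if k: "k \<in> {1..n * m}" for k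
    proof -
      obtain i j where ij: "i \<in> {1..n}" "j \<in> {1..m}" "k = m * (i - 1) + j"
        by (rule tensor_indexE[OF k])
      show ?thesis unfolding ij(3) phi_hom_gen[OF ij(1,2)] by (intro min_tensor_tensor cuntz_gen_in ij)
    qed
    moreover have "phi_hom n m (cuntz_unit (n * m)) \<in> ?M"
      by (simp add: phi_hom_unit min_tensor_tensor cuntz_unit_in)
    ultimately show "insert (cuntz_unit (n * m)) (cuntz_gen (n * m) ` {1..n * m})
        \<subseteq> {x \<in> block_preserving. phi_hom n m x \<in> ?M}"
      using cuntz_algebra_preserving[of "n * m"] cuntz_unit_in cuntz_gen_in by blast
  qed
  thus "x \<in> cuntz_algebra (n * m) \<Longrightarrow> phi_hom n m x \<in> ?M" by blast
qed

text \<open>\<open>phi_hom\<close> witnesses the choice in the definition of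
  \<open>cuntz_phi\<close>. From here on the chosen map is used only through these
  properties.\<close>

lemma cuntz_phi:
  shows "star_hom (cuntz_algebra (n * m)) (min_tensor (cuntz_algebra n) (cuntz_algebra m)) (cuntz_phi n m)"
    and "i \<in> {1..n} \<Longrightarrow> j \<in> {1..m} \<Longrightarrow>
      cuntz_phi n m (cuntz_gen (n * m) (m * (i - 1) + j)) = cuntz_gen n i \<otimes>\<^sub>o cuntz_gen m j"
proof -
  have "star_hom (cuntz_algebra (n * m)) (min_tensor (cuntz_algebra n) (cuntz_algebra m)) (phi_hom n m)"
    using star_hom_phi[of n m] cuntz_algebra_preserving[of "n * m"] phi_hom_range[of _ n m]
    unfolding star_hom_def by (auto simp: subset_iff)
  hence "\<exists>f. star_hom (cuntz_algebra (n * m)) (min_tensor (cuntz_algebra n) (cuntz_algebra m)) f \<and>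
     f (cuntz_unit (n * m)) = cuntz_unit n \<otimes>\<^sub>o cuntz_unit m \<and>
     (\<forall>i\<in>{1..n}. \<forall>j\<in>{1..m}. f (cuntz_gen (n * m) (m * (i - 1) + j)) = cuntz_gen n i \<otimes>\<^sub>o cuntz_gen m j)"
    using phi_hom_unit phi_hom_gen by blast
  from someI_ex[OF this, folded cuntz_phi_def]
  show "star_hom (cuntz_algebra (n * m)) (min_tensor (cuntz_algebra n) (cuntz_algebra m)) (cuntz_phi n m)"
    "i \<in> {1..n} \<Longrightarrow> j \<in> {1..m} \<Longrightarrow>
      cuntz_phi n m (cuntz_gen (n * m) (m * (i - 1) + j)) = cuntz_gen n i \<otimes>\<^sub>o cuntz_gen m j"
    by blast+
qed

section \<open>The comultiplication\<close>

lemma star_closed_cuntz_sum: "star_closed cuntz_sum"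
  unfolding cuntz_sum_def
  by (intro star_closed_c0_sum star_closed_subalgebra cstar_subalgebra_cuntz)

lemma extend_in_c0_sum:
  assumes "n \<in> N" "x \<in> A n" "\<And>k. 0 \<in> A k"
  shows "extend_op (Pair n) x \<in> c0_sum N A"
proof -
  have "(\<lambda>k. norm (if k = n then x else 0)) \<longlonglongrightarrow> 0"
    by (rule tendsto_eventually, rule eventually_mono[OF eventually_gt_at_top[of n]]) simp
  thus ?thesis
    using assms unfolding c0_sum_def block_diag_single[symmetric] by fastforce
qed

lemma extend_in_cuntz_sum: "1 \<le> n \<Longrightarrow> x \<in> cuntz_algebra n \<Longrightarrow> extend_op (Pair n) x \<in> cuntz_sum"
  unfolding cuntz_sum_def
  by (intro extend_in_c0_sum) (auto intro: cstar_subalgebraD(2)[OF cstar_subalgebra_cuntz])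

section \<open>Relations between the units and the generators\<close>

lemma cuntz_unit_mult: "cuntz_unit n * cuntz_unit n = cuntz_unit n"
proof -
  have "cuntz_unit n * cuntz_unit n
      = block_diag (\<lambda>S. (if cuntz_family n S then 1 else 0) * (if cuntz_family n S then 1 else 0))"
    unfolding cuntz_unit_def by (rule block_diag_mult[symmetric]) (rule cuntz_unit_block_norm)+
  also have "\<dots> = cuntz_unit n"
    unfolding cuntz_unit_def by (intro arg_cong[where f=block_diag] ext) simp
  finally show ?thesis .
qed

lemma adj_cuntz_unit: "adj (cuntz_unit n) = cuntz_unit n"
proof -
  have "adj (cuntz_unit n) = block_diag (\<lambda>S. adj (if cuntz_family n S then 1 else 0))"
    unfolding cuntz_unit_def by (rule block_diag_adj[symmetric]) (rule cuntz_unit_block_norm)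
  also have "\<dots> = cuntz_unit n"
    unfolding cuntz_unit_def by (intro arg_cong[where f=block_diag] ext) simp
  finally show ?thesis .
qed

lemma cuntz_unit_gen:
  assumes "i \<in> {1..n}"
  shows "cuntz_unit n * cuntz_gen n i = cuntz_gen n i"
proof -
  have "cuntz_unit n * cuntz_gen n i
      = block_diag (\<lambda>S. (if cuntz_family n S then 1 else 0) * (if cuntz_family n S then S i else 0))"
    unfolding cuntz_unit_def cuntz_gen_def
    by (rule block_diag_mult[symmetric]) (rule cuntz_unit_block_norm cuntz_gen_block_norm[OF assms])+
  also have "\<dots> = cuntz_gen n i"
    unfolding cuntz_gen_def by (intro arg_cong[where f=block_diag] ext) simp
  finally show ?thesis .
qed

lemma cuntz_gen_unit:
  assumes "i \<in> {1..n}"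
  shows "cuntz_gen n i * cuntz_unit n = cuntz_gen n i"
proof -
  have "cuntz_gen n i * cuntz_unit n
      = block_diag (\<lambda>S. (if cuntz_family n S then S i else 0) * (if cuntz_family n S then 1 else 0))"
    unfolding cuntz_unit_def cuntz_gen_def
    by (rule block_diag_mult[symmetric]) (rule cuntz_unit_block_norm cuntz_gen_block_norm[OF assms])+
  also have "\<dots> = cuntz_gen n i"
    unfolding cuntz_gen_def by (intro arg_cong[where f=block_diag] ext) simp
  finally show ?thesis .
qed

lemma cuntz_phi_zero: "cuntz_phi n m 0 = 0"
proof -
  have "cuntz_phi n m (0 + 0) = cuntz_phi n m 0 + cuntz_phi n m 0"
    using cuntz_phi(1)[of n m] cstar_subalgebraD(2)[OF cstar_subalgebra_cuntz, of "n * m"]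
    unfolding star_hom_def by blast
  thus ?thesis by simp
qed

section \<open>The comultiplication seen in a single summand of the tensor product\<close>

lemma inj_summand: "inj (map_prod (Pair m) (Pair l))"
  by (auto simp: inj_def)

lemma cuntz_Delta_part_zero: "cuntz_Delta_part n 0 = 0"
  unfolding cuntz_Delta_part_def
  by (rule sum.neutral) (auto simp: cuntz_phi_zero summand_incl_def extend_op_zero inj_summand)

lemma compress_extend_Pair:
  "compress_op (Pair k) (extend_op (Pair n) x) = (if k = n then x else 0)"
  unfolding block_diag_single[symmetric] by (rule compress_block_diag[where K="norm x"]) simp

text \<open>All components of the argument other than the \<open>n\<close>-th vanish and
  \<open>cuntz_Delta_part\<close> maps 0 to 0, so the series collapses to one term.\<close>

lemma cuntz_Delta_single: "cuntz_Delta (extend_op (Pair n) x) = cuntz_Delta_part n x"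
proof -
  have "(\<lambda>k. if k = n then cuntz_Delta_part k x else 0) sums cuntz_Delta_part n x"
    by (rule sums_single)
  moreover have "(\<lambda>k. if k = n then cuntz_Delta_part k x else 0)
      = (\<lambda>k. cuntz_Delta_part k (compress_op (Pair k) (extend_op (Pair n) x)))"
    by (auto simp: compress_extend_Pair cuntz_Delta_part_zero)
  ultimately show ?thesis unfolding cuntz_Delta_def by (simp add: sums_iff)
qed

lemma finite_factorizations: "finite {(m :: nat, l). 1 \<le> m \<and> 1 \<le> l \<and> m * l = n}"
proof (rule finite_subset)
  show "{(m, l). 1 \<le> m \<and> 1 \<le> l \<and> m * l = n} \<subseteq> {..n} \<times> {..n}" by auto
qed simp

text \<open>Different pairs of factors belong to summands supported on disjoint sets of basis
  vectors, so multiplication by an element of one summand isolates the corresponding term of the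
  sum.\<close>

lemma
  assumes m: "1 \<le> m" and l: "1 \<le> l"
  shows summand_mult_Delta_part:
      "summand_incl m l y * cuntz_Delta_part (m * l) x = summand_incl m l (y * cuntz_phi m l x)"
    and Delta_part_mult_summand:
      "cuntz_Delta_part (m * l) x * summand_incl m l y = summand_incl m l (cuntz_phi m l x * y)"
proof -
  let ?F = "{(m', l'). 1 \<le> m' \<and> 1 \<le> l' \<and> m' * l' = m * l}"
  have dis: "summand_incl m l y * summand_incl a b z = 0" "summand_incl a b z * summand_incl m l y = 0"
    if "\<not> (a = m \<and> b = l)" for a b y z
    unfolding summand_incl_def using that by (auto intro!: extend_op_mult_disjoint inj_summand)
  have same: "summand_incl m l y * summand_incl m l z = summand_incl m l (y * z)" for y z
    unfolding summand_incl_def by (intro extend_op_mult inj_summand)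
  have in_F: "(m, l) \<in> ?F" using m l by simp
  have "summand_incl m l y * cuntz_Delta_part (m * l) x
      = (\<Sum>p\<in>?F. if p = (m, l) then summand_incl m l (y * cuntz_phi m l x) else 0)"
    unfolding cuntz_Delta_part_def sum_distrib_left
    by (intro sum.cong refl) (auto simp: same, (metis dis)+)
  thus "summand_incl m l y * cuntz_Delta_part (m * l) x = summand_incl m l (y * cuntz_phi m l x)"
    using in_F by (simp only: sum.delta'[OF finite_factorizations] sum.delta[OF finite_factorizations] if_True)
  have "cuntz_Delta_part (m * l) x * summand_incl m l y
      = (\<Sum>p\<in>?F. if p = (m, l) then summand_incl m l (cuntz_phi m l x * y) else 0)"
    unfolding cuntz_Delta_part_def sum_distrib_right
    by (intro sum.cong refl) (auto simp: same, (metis dis)+)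
  thus "cuntz_Delta_part (m * l) x * summand_incl m l y = summand_incl m l (cuntz_phi m l x * y)"
    using in_F by (simp only: sum.delta'[OF finite_factorizations] sum.delta[OF finite_factorizations] if_True)
qed

lemma summand_incl_tensor:
  "summand_incl m l (a \<otimes>\<^sub>o b) = extend_op (Pair m) a \<otimes>\<^sub>o extend_op (Pair l) b"
  unfolding summand_incl_def by (rule extend_op_tensor) auto

section \<open>Universal R-matrices\<close>

lemma flip_op_mult: "flip_op (S * T) = flip_op S * flip_op T"
  unfolding flip_op_def by (rule compress_op_mult_bij) (rule bij_swap)

lemma flip_op_flip [simp]: "flip_op (flip_op T) = T"
proof (rule bop_coord_eqI)
  have pull: "ell2_fun (ell2_pull prod.swap \<psi>) p = ell2_fun \<psi> (prod.swap p)" for \<psi> :: "('a \<times> 'a) ell2" and p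
    by (simp add: ell2_fun_pull)
  show "ell2_fun (flip_op (flip_op T) \<cdot> ket p) q = ell2_fun (T \<cdot> ket p) q" for p q
    by (simp add: flip_op_def compress_op_ket pull)
qed

text \<open>By the centralizer identity every element of \<open>B\<close> annihilates the difference
  \<open>y\<close> of the two sides from the left. Since \<open>adj y\<close> is such an element,
  \<open>adj y * y = 0\<close> and so \<open>y = 0\<close>.\<close>

lemma multiplier_right_module:
  assumes B: "cstar_subalgebra B" and X: "X \<in> multipliers B" and b: "b \<in> B" and d: "d \<in> B"
  shows "fst X (b * d) = fst X b * d"
proof -
  obtain L R where LR: "X = (L, R)" by (cases X)
  have cent: "a * L c = R a * c" if "a \<in> B" "c \<in> B" for a c
    using X that unfolding LR multipliers_def by blast
  have L: "L c \<in> B" if "c \<in> B" for c using X that unfolding LR multipliers_def by auto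
  define y where "y = L (b * d) - L b * d"
  have "y \<in> B" unfolding y_def
    by (intro cstar_subalgebra_diff cstar_subalgebraD(4) B L b d)
  have "a * y = 0" if a: "a \<in> B" for a
  proof -
    have "a * L (b * d) = (a * L b) * d"
      using cent[OF a b] cent[OF a cstar_subalgebraD(4)[OF B b d]] by (simp add: mult.assoc)
    thus ?thesis by (simp add: y_def algebra_simps)
  qed
  from this[OF cstar_subalgebraD(6)[OF B \<open>y \<in> B\<close>]] have "y = 0"
    by (simp add: adj_mult_self_eq_0_iff)
  thus ?thesis by (simp add: y_def LR)
qed

text \<open>The first claim evaluates the unitarity relation at \<open>b\<close>. It identifies the
  right action of \<open>X\<close> on \<open>adj (fst X b)\<close> as \<open>adj b\<close>; the
  centralizer identity at this element then gives the second claim.\<close>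

lemma unitary_multiplier_isometric:
  assumes B: "cstar_subalgebra B" and X: "unitary_multiplier B X" and b: "b \<in> B"
  shows "fst (mult_adj B X) (fst X b) = b" "adj (fst X b) * fst X b = adj b * b"
proof -
  have mult: "X \<in> multipliers B" and one: "mult_times B (mult_adj B X) X = mult_one B"
    using X unfolding unitary_multiplier_def by auto
  show inv: "fst (mult_adj B X) (fst X b) = b"
    using fun_cong[OF arg_cong[OF one, of fst], of b] b by (simp add: mult_times_def mult_one_def)
  have L: "fst X b \<in> B" and cent: "\<And>a. a \<in> B \<Longrightarrow> a * fst X b = snd X a * b"
    using mult b unfolding multipliers_def by (auto simp: case_prod_beta)
  have "adj (snd X (adj (fst X b))) = b" using inv L by (simp add: mult_adj_def)
  hence "snd X (adj (fst X b)) = adj b" by (metis adj_adj)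
  with cent[OF cstar_subalgebraD(6)[OF B L]] show "adj (fst X b) * fst X b = adj b * b" by simp
qed

text \<open>Evaluate the defining relation at \<open>fst R b\<close>: there the adjoint of
  \<open>R\<close> cancels \<open>R\<close>. On the other side the flip is multiplicative and an
  involution, so the flipped multiplier is left multiplication by \<open>flip_op t\<close>.\<close>

lemma universal_R_matrix_intertwines:
  assumes B: "cstar_subalgebra (min_tensor A A)" and R: "universal_R_matrix A \<Delta> R"
    and x: "x \<in> A" "\<Delta> x = mult_embed (min_tensor A A) t" and b: "b \<in> min_tensor A A"
  shows "fst R (t * b) = flip_op t * fst R b"
proof -
  let ?B = "min_tensor A A"
  have U: "unitary_multiplier ?B R"
    and eq: "mult_times ?B (mult_times ?B R (\<Delta> x)) (mult_adj ?B R) = mult_flip A (\<Delta> x)"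
    using R x(1) unfolding universal_R_matrix_def opposite_comult_def by auto
  have Lb: "fst R b \<in> ?B"
    using U b unfolding unitary_multiplier_def multipliers_def by (auto simp: case_prod_beta)
  have "fst (mult_times ?B (mult_times ?B R (\<Delta> x)) (mult_adj ?B R)) (fst R b) = fst R (t * b)"
    using b Lb unitary_multiplier_isometric(1)[OF B U b] by (simp add: mult_times_def x(2) mult_embed_def)
  moreover have "fst (mult_flip A (\<Delta> x)) (fst R b) = flip_op t * fst R b"
    using Lb by (simp add: mult_flip_def x(2) mult_embed_def flip_op_min_tensor flip_op_mult)
  ultimately show ?thesis unfolding eq by simp
qed

section \<open>Two representations of the Cuntz algebra on two generators\<close>

definition shift_op :: "('x \<Rightarrow> 'x) \<Rightarrow> 'x bop" where
  "shift_op f = bop_of (ell2_push f)"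

lemma shift_op_apply: "inj f \<Longrightarrow> shift_op f \<cdot> \<psi> = ell2_push f \<psi>"
  unfolding shift_op_def
  by (rule bop_of_apply[where K=1]) (auto simp: ell2_push_linear norm_ell2_push)

lemma adj_shift_op_apply:
  assumes "inj f"
  shows "adj (shift_op f) \<cdot> \<psi> = ell2_pull f \<psi>"
  by (rule cinner_eqI) (simp add: cinner_adj shift_op_apply assms cinner_pull)

text \<open>Two injections whose ranges partition the basis give isometries with orthogonal ranges
  that together span the space.\<close>

lemma cuntz_family_shift:
  fixes f g :: "'x \<Rightarrow> 'x"
  assumes fg: "inj f" "inj g" "range f \<inter> range g = {}" "range f \<union> range g = UNIV"
  shows "cuntz_family 2 (\<lambda>k. if k = 1 then shift_op f else shift_op g)"
proof -
  have dis: "ell2_pull f' (ell2_push g' \<psi>) = 0"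
    if "inj f'" "inj g'" "range f' \<inter> range g' = {}" for f' g' :: "'x \<Rightarrow> 'x" and \<psi>
    using that by (intro ell2_eqI) (auto simp: ell2_fun_pull ell2_fun_push)
  note dis' = dis[OF fg(1-3)] dis[OF fg(2,1) fg(3)[unfolded Int_commute[of "range f"]]]
  have "adj (shift_op f) * shift_op f = 1" "adj (shift_op g) * shift_op g = 1"
    "adj (shift_op f) * shift_op g = 0" "adj (shift_op g) * shift_op f = 0"
    by (auto intro!: bop_eqI simp: fg(1,2) shift_op_apply adj_shift_op_apply dis')
  moreover have "shift_op f * adj (shift_op f) + shift_op g * adj (shift_op g) = 1"
  proof (rule bop_ket_eqI)
    fix x
    consider y where "x = f y" "x \<notin> range g" | y where "x = g y" "x \<notin> range f" using fg(3,4) by blast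
    thus "(shift_op f * adj (shift_op f) + shift_op g * adj (shift_op g)) \<cdot> ket x = 1 \<cdot> ket x"
      by cases (simp_all add: fg(1,2) shift_op_apply adj_shift_op_apply pull_ket pull_ket_notin push_ket)
  qed
  ultimately show ?thesis unfolding cuntz_family_def
    by (auto simp: numeral_2_eq_2)
qed

abbreviation even_op :: "nat bop" where "even_op \<equiv> shift_op (\<lambda>k. 2 * k)"
abbreviation odd_op :: "nat bop" where "odd_op \<equiv> shift_op (\<lambda>k. Suc (2 * k))"

text \<open>The digit in the name is the number of the generator that is represented by
  \<open>even_op\<close> and therefore fixes \<open>ket 0\<close>.\<close>

definition rep_fix1 :: "nat \<Rightarrow> nat bop" where "rep_fix1 k = (if k = 1 then even_op else odd_op)"
definition rep_fix2 :: "nat \<Rightarrow> nat bop" where "rep_fix2 k = (if k = 1 then odd_op else even_op)"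

lemma inj_even_odd: "inj (\<lambda>k :: nat. 2 * k)" "inj (\<lambda>k :: nat. Suc (2 * k))"
  by (auto simp: inj_def)

lemma cuntz_family_rep: "cuntz_family 2 rep_fix1" "cuntz_family 2 rep_fix2"
proof -
  have dis: "range (\<lambda>k :: nat. 2 * k) \<inter> range (\<lambda>k. Suc (2 * k)) = {}" by auto presburger
  have cov: "range (\<lambda>k :: nat. 2 * k) \<union> range (\<lambda>k. Suc (2 * k)) = UNIV"
  proof -
    have "n \<in> range (\<lambda>k. 2 * k) \<union> range (\<lambda>k. Suc (2 * k))" for n :: nat
      by (cases "even n") (auto elim!: evenE oddE)
    thus ?thesis by blast
  qed
  show "cuntz_family 2 rep_fix1"
    using cuntz_family_shift[OF inj_even_odd dis cov] by (simp add: rep_fix1_def[abs_def])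
  show "cuntz_family 2 rep_fix2"
    using cuntz_family_shift[OF inj_even_odd(2,1)] dis cov
    by (simp add: rep_fix2_def[abs_def] Int_commute Un_commute)
qed

lemma even_op_ket_0: "even_op \<cdot> ket 0 = ket 0"
  using push_ket[OF inj_even_odd(1), of 0] by (simp add: shift_op_apply inj_even_odd)

text \<open>The adjoint of \<open>C\<close> lowers the index of every basis vector, so each coordinate of a vector
  fixed by \<open>C \<otimes> T\<close> reduces to one with a smaller index.\<close>

lemma tensor_fixed_vector_eq_0:
  fixes C :: "'x bop" and T :: "'y bop" and r :: "'x \<Rightarrow> nat"
  assumes C: "\<And>u. adj C \<cdot> ket u = 0 \<or> (\<exists>u'. adj C \<cdot> ket u = ket u' \<and> r u' < r u)"
    and fixed: "(C \<otimes>\<^sub>o T) \<cdot> \<xi> = \<xi>"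
  shows "\<xi> = 0"
proof -
  have "cinner (ket u \<otimes>\<^sub>v w) \<xi> = 0" for u w
  proof (induction "r u" arbitrary: u w rule: less_induct)
    case less
    have "cinner (ket u \<otimes>\<^sub>v w) \<xi> = cinner (adj (C \<otimes>\<^sub>o T) \<cdot> (ket u \<otimes>\<^sub>v w)) \<xi>"
      unfolding cinner_adj fixed ..
    also have "\<dots> = cinner ((adj C \<cdot> ket u) \<otimes>\<^sub>v (adj T \<cdot> w)) \<xi>"
      by (simp add: tensor_op_adj tensor_op_apply)
    also have "\<dots> = 0" using C[of u] less by auto
    finally show ?case .
  qed
  from this[of _ "ket _"] show ?thesis
    by (intro ell2_eqI, case_tac x) (simp add: ket_tensor)
qed

section \<open>Blocks of the two representations\<close>

lemma cuntz_gen_extend: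
  assumes "i \<in> {1..n}" "cuntz_family n S"
  shows "extend_op (Pair S) 1 * cuntz_gen n i = extend_op (Pair S) (S i)"
proof -
  have "extend_op (Pair S) 1 * cuntz_gen n i
      = extend_op (Pair S) (1 * (if cuntz_family n S then S i else 0))"
    unfolding cuntz_gen_def
    by (rule extend_mult_block_diag) (rule cuntz_gen_block_norm[OF assms(1)])
  thus ?thesis using assms(2) by simp
qed

lemma cuntz_unit_extend:
  assumes "cuntz_family n S"
  shows "extend_op (Pair S) 1 * cuntz_unit n = extend_op (Pair S) 1"
proof -
  have "extend_op (Pair S) 1 * cuntz_unit n
      = extend_op (Pair S) (1 * (if cuntz_family n S then 1 else 0))"
    unfolding cuntz_unit_def by (rule extend_mult_block_diag) (rule cuntz_unit_block_norm)
  thus ?thesis using assms by simp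
qed

lemma cuntz_gen_ket:
  assumes "i \<in> {1..n}" "cuntz_family n S"
  shows "cuntz_gen n i \<cdot> ket (S, k) = ell2_push (Pair S) (S i \<cdot> ket k)"
proof -
  have "cuntz_gen n i \<cdot> ket (S, k)
      = ell2_push (Pair S) ((if cuntz_family n S then S i else 0) \<cdot> ket k)"
    unfolding cuntz_gen_def by (rule block_diag_ket) (rule cuntz_gen_block_norm[OF assms(1)])
  thus ?thesis using assms(2) by simp
qed

text \<open>The projection onto the block of \<open>S\<close> inside the \<open>n\<close>-th
  summand. If \<open>S\<close> is a Cuntz family, multiplying a generator by this projection turns
  it into the concrete operator \<open>S i\<close>.\<close>

definition rep_proj :: "nat \<Rightarrow> (nat \<Rightarrow> nat bop) \<Rightarrow> (nat \<times> cuntz_index) bop" where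
  "rep_proj n S = extend_op (Pair n) (extend_op (Pair S) 1)"

text \<open>Elements of \<open>cuntz_sum\<close> are block diagonal twice: over the summands, and
  inside each summand over the representations.\<close>

lemma rep_proj_commute:
  assumes "x \<in> cuntz_sum"
  shows "rep_proj n S * x = x * rep_proj n S"
proof -
  obtain a where x: "x = block_diag a" "\<forall>n\<in>{1..}. a n \<in> cuntz_algebra n" "\<forall>n. n \<notin> {1..} \<longrightarrow> a n = 0"
    "(\<lambda>n. norm (a n)) \<longlonglongrightarrow> 0"
    using assms unfolding cuntz_sum_def c0_sum_def by blast
  obtain K where K: "\<And>n. norm (a n) \<le> K"
    using convergent_imp_Bseq[OF convergentI[OF x(4)]] by (auto simp: Bseq_def)
  have "a n \<in> block_preserving"
    using x(2,3) cuntz_algebra_preserving[of n] cstar_subalgebraD(2)[OF cstar_subalgebra_block_preserving]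
    by (cases "n \<in> {1..}") auto
  hence "extend_op (Pair S) 1 * a n = a n * extend_op (Pair S) 1"
    unfolding block_preserving_def by blast
  thus ?thesis
    by (simp add: rep_proj_def x(1) extend_mult_block_diag[OF K] block_diag_mult_extend[OF K])
qed

theorem theorem1p3:
  shows "\<not> (\<exists>R. universal_R_matrix cuntz_sum cuntz_comult R)"
proof
  assume "\<exists>R. universal_R_matrix cuntz_sum cuntz_comult R"
  then obtain R where R: "universal_R_matrix cuntz_sum cuntz_comult R" by blast
  let ?B = "min_tensor cuntz_sum cuntz_sum"
  let ?L = "fst R"
  have B: "cstar_subalgebra ?B" by (intro cstar_subalgebra_min_tensor star_closed_cuntz_sum)
  have U: "unitary_multiplier ?B R" using R unfolding universal_R_matrix_def by blast
  hence mult: "R \<in> multipliers ?B" unfolding unitary_multiplier_def by blast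

  define e where "e = extend_op (Pair (2 :: nat)) (cuntz_unit 2)"
  define G where "G i = extend_op (Pair (2 :: nat)) (cuntz_gen 2 i)" for i
  \<comment> \<open>\<open>p\<close> is the unit of the chosen summand. It lies in the tensor
    product, so the multiplier \<open>R\<close> can be applied to it; \<open>?L p\<close> stands for
    the operator \<open>R\<close> on this summand.\<close>
  define p where "p = e \<otimes>\<^sub>o e"
  define d where "d = G 1 \<otimes>\<^sub>o G 2"
  define x where "x = extend_op (Pair (4 :: nat)) (cuntz_gen 4 2)"
  define t where "t = cuntz_Delta x"
  \<comment> \<open>The pair of representations is chosen so that \<open>G 1\<close> in the left
    factor and \<open>G 2\<close> in the right factor both fix the vacuum, whereas flipping them
    puts \<open>odd_op\<close> on both sides.\<close>
  define q where "q = rep_proj 2 rep_fix1 \<otimes>\<^sub>o rep_proj 2 rep_fix2"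
  define \<Omega> where "\<Omega> = ket (2 :: nat, (rep_fix1, 0 :: nat)) \<otimes>\<^sub>v ket (2 :: nat, (rep_fix2, 0 :: nat))"

  have x: "x \<in> cuntz_sum" unfolding x_def by (intro extend_in_cuntz_sum cuntz_gen_in) auto
  have p_in: "p \<in> ?B"
    unfolding p_def e_def by (intro min_tensor_tensor extend_in_cuntz_sum cuntz_unit_in) auto
  have d_in: "d \<in> ?B"
    unfolding d_def G_def by (intro min_tensor_tensor extend_in_cuntz_sum cuntz_gen_in) auto

  \<comment> \<open>The index 2 is \<open>2 * (1 - 1) + 2\<close>, that is, \<open>i = 1\<close> and
    \<open>j = 2\<close>.\<close>
  have phi: "cuntz_phi 2 2 (cuntz_gen 4 2) = cuntz_gen 2 1 \<otimes>\<^sub>o cuntz_gen 2 2"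
    using cuntz_phi(2)[of 1 2 2 2] by (simp flip: numeral_2_eq_2)
  have p_incl: "p = summand_incl 2 2 (cuntz_unit 2 \<otimes>\<^sub>o cuntz_unit 2)"
    by (simp add: p_def e_def summand_incl_tensor)
  have d_incl: "d = summand_incl 2 2 (cuntz_gen 2 1 \<otimes>\<^sub>o cuntz_gen 2 2)"
    by (simp add: d_def G_def summand_incl_tensor)
  have t: "t = cuntz_Delta_part (2 * 2) (cuntz_gen 4 2)"
    unfolding t_def x_def cuntz_Delta_single by simp
  have tp: "t * p = d" and pt: "p * t = d"
    unfolding t p_incl d_incl
    by (simp_all only: summand_mult_Delta_part Delta_part_mult_summand one_le_numeral phi)
      (simp_all add: tensor_op_mult cuntz_unit_gen cuntz_gen_unit)
  have ee: "e * e = e" and adj_e: "adj e = e"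
    by (simp_all add: e_def extend_op_mult cuntz_unit_mult adj_extend_op adj_cuntz_unit)
  have pp: "p * p = p" and adj_p: "adj p = p" and flip_p: "flip_op p = p"
    by (simp_all add: p_def tensor_op_mult ee tensor_op_adj adj_e flip_op_tensor)
  have pd: "p * d = d" unfolding tp[symmetric] using pt tp pp by (metis mult.assoc)

  have proj_gen: "rep_proj 2 S * G i = extend_op (Pair 2) (extend_op (Pair S) (S i))"
    if "cuntz_family 2 S" "i \<in> {1..2}" for S i
    unfolding rep_proj_def G_def using that by (simp add: extend_op_mult cuntz_gen_extend)
  have proj_e: "rep_proj 2 S * e = rep_proj 2 S" if "cuntz_family 2 S" for S
    unfolding rep_proj_def e_def using that by (simp add: extend_op_mult cuntz_unit_extend)
  have qp: "q * p = q"
    by (simp add: q_def p_def tensor_op_mult proj_e cuntz_family_rep)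
  have proj_ket: "rep_proj 2 S \<cdot> ket (2, (S, k)) = ket (2, (S, k))" for S k
    by (simp add: rep_proj_def extend_op_ket push_ket)
  have q_\<Omega>: "q \<cdot> \<Omega> = \<Omega>" by (simp add: q_def \<Omega>_def tensor_op_apply proj_ket)
  have G_ket: "G i \<cdot> ket (2, (S, 0)) = ket (2, (S, 0))"
    if "cuntz_family 2 S" "i \<in> {1..2}" "S i = even_op" for S i
    using that
    by (simp add: G_def extend_op_ket push_ket cuntz_gen_ket even_op_ket_0 del: atLeastAtMost_iff)
  have d_\<Omega>: "d \<cdot> \<Omega> = \<Omega>"
    by (simp add: d_def \<Omega>_def tensor_op_apply G_ket cuntz_family_rep rep_fix1_def rep_fix2_def)

  define \<xi> where "\<xi> = ?L p \<cdot> \<Omega>"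
  have Lp: "?L p \<in> ?B" using mult p_in unfolding multipliers_def by (auto simp: case_prod_beta)
  \<comment> \<open>\<open>d\<close> equals both \<open>p * d\<close> and \<open>t * p\<close>. The
    first form uses that \<open>R\<close> acts as a right module map, the second uses the
    intertwining relation; comparing them on \<Omega> shows that \<open>flip_op t\<close> fixes
    \<xi>.\<close>
  have "?L d = ?L p * d"
    using multiplier_right_module[OF B mult p_in d_in] by (simp add: pd)
  moreover have "?L d = flip_op t * ?L p"
    using universal_R_matrix_intertwines[OF B R x _ p_in, of t]
    by (simp add: cuntz_comult_def t_def tp[unfolded t_def])
  ultimately have "?L p * d = flip_op t * ?L p" by simp
  hence "(?L p * d) \<cdot> \<Omega> = (flip_op t * ?L p) \<cdot> \<Omega>" by simp
  hence t_\<xi>: "flip_op t \<cdot> \<xi> = \<xi>" by (simp add: d_\<Omega> \<xi>_def)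
  \<comment> \<open>As \<open>q\<close> commutes with the tensor product, \<xi> stays in the block
    of \<Omega>.\<close>
  have "q * ?L p = ?L p * q"
    unfolding q_def by (rule min_tensor_commute[OF Lp rep_proj_commute rep_proj_commute])
  hence "(q * ?L p) \<cdot> \<Omega> = (?L p * q) \<cdot> \<Omega>" by simp
  hence q_\<xi>: "q \<cdot> \<xi> = \<xi>" by (simp add: q_\<Omega> \<xi>_def)
  \<comment> \<open>\<open>p\<close> can be inserted because \<open>q * p = q\<close>, and it is
    invariant under the flip; it cuts \<open>t\<close> down to \<open>d\<close>, whose flip is an
    elementary tensor.\<close>
  have "q * flip_op t = q * (flip_op p * flip_op t)"
    unfolding flip_p mult.assoc[symmetric] qp ..
  also have "\<dots> = q * (G 2 \<otimes>\<^sub>o G 1)"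
    unfolding flip_op_mult[symmetric] pt d_def flip_op_tensor ..
  also have "\<dots> = extend_op (Pair 2) (extend_op (Pair rep_fix1) odd_op) \<otimes>\<^sub>o (rep_proj 2 rep_fix2 * G 1)"
    by (simp add: q_def tensor_op_mult proj_gen cuntz_family_rep) (simp add: rep_fix1_def)
  finally have "(extend_op (Pair 2) (extend_op (Pair rep_fix1) odd_op) \<otimes>\<^sub>o (rep_proj 2 rep_fix2 * G 1)) \<cdot> \<xi>
      = q \<cdot> flip_op t \<cdot> \<xi>" by (metis bop_apply_simps(6))
  hence fixed: "(extend_op (Pair 2) (extend_op (Pair rep_fix1) odd_op) \<otimes>\<^sub>o (rep_proj 2 rep_fix2 * G 1)) \<cdot> \<xi> = \<xi>"
    by (simp add: t_\<xi> q_\<xi>)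
  have "\<xi> = 0"
  \<comment> \<open>\<open>snd \<circ> snd\<close> is the position inside the block. The adjoint of
    \<open>odd_op\<close> sends position \<open>2 * j + 1\<close> to \<open>j\<close> and
    annihilates even positions, among them 0.\<close>
  proof (rule tensor_fixed_vector_eq_0[OF _ fixed, where r="snd \<circ> snd"])
    fix u :: "nat \<times> cuntz_index"
    let ?C = "extend_op (Pair 2) (extend_op (Pair rep_fix1) odd_op) :: (nat \<times> cuntz_index) bop"
    obtain n S k where u: "u = (n, (S, k))" by (metis prod.exhaust)
    have C: "adj ?C = extend_op (Pair 2) (extend_op (Pair rep_fix1) (adj odd_op))"
      by (simp add: adj_extend_op)
    show "adj ?C \<cdot> ket u = 0 \<or> (\<exists>u'. adj ?C \<cdot> ket u = ket u' \<and> (snd \<circ> snd) u' < (snd \<circ> snd) u)"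
    proof (cases "n = 2 \<and> S = rep_fix1 \<and> odd k")
      case True
      then obtain j where k: "k = Suc (2 * j)" by (auto elim: oddE)
      have "adj odd_op \<cdot> ket k = ket j"
        unfolding k using pull_ket[OF inj_even_odd(2), of j] by (simp only: adj_shift_op_apply inj_even_odd)
      hence "adj ?C \<cdot> ket u = ket (2, (rep_fix1, j))"
        using True by (simp add: C u extend_op_ket push_ket)
      moreover have "(snd \<circ> snd) (2, (rep_fix1, j)) < (snd \<circ> snd) u" by (simp add: u k)
      ultimately show ?thesis by blast
    next
      case False
      have "adj odd_op \<cdot> ket k = 0" if "even k"
        unfolding adj_shift_op_apply[OF inj_even_odd(2)]
        by (rule pull_ket_notin[OF inj_even_odd(2)]) (use that in auto)
      moreover have "u \<notin> range (Pair 2)" if "n \<noteq> 2" using that by (auto simp: u)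
      moreover have "(S, k) \<notin> range (Pair rep_fix1)" if "S \<noteq> rep_fix1" using that by auto
      ultimately have "adj ?C \<cdot> ket u = 0"
        using False by (cases "n = 2"; cases "S = rep_fix1")
          (simp_all add: C u extend_op_ket extend_op_ket_notin)
      thus ?thesis by blast
    qed
  qed
  moreover have "complex_of_real ((norm \<xi>)\<^sup>2) = 1"
  proof -
    \<comment> \<open>Unitarity gives \<open>adj (?L p) * ?L p = p\<close>. That \<open>p\<close>
      fixes \<Omega> follows from \<open>p * d = d\<close>, since \<open>d\<close> fixes
      \<Omega>.\<close>
    have "complex_of_real ((norm \<xi>)\<^sup>2) = cinner \<Omega> ((p * d) \<cdot> \<Omega>)"
      unfolding \<xi>_def norm_sq_apply unitary_multiplier_isometric(2)[OF B U p_in] adj_p pp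
      by (simp add: d_\<Omega>)
    also have "\<dots> = 1" by (simp add: pd d_\<Omega>) (simp add: \<Omega>_def ket_tensor)
    finally show ?thesis .
  qed
  ultimately show False by simp
qed

end
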